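(* Let $(k,\,')$ be a differential field with $\mathrm{char}(k)\neq 2$, let $\alpha,\beta\in k^\times$, and let $Q=(\alpha,\beta)_k$ be the quaternion algebra with generators $u,v$ satisfying $u^2=\alpha$, $v^2=\beta$, $vu=-uv$. Let $d$ be a derivation on $Q$ extending $'$, written as $d=d_{(u,v)}+\partial_\vartheta$ with $\vartheta=a_1u+a_2v+a_3uv$, $a_1,a_2,a_3\in k$. Let $\xi\in\overline{k}$ be such that $\xi^2=\alpha$, and let $(L,\,')$ be a differential field extension of $(k(\xi),\,')$. (a) If $(Q,d)$ is split by $(L,\,')$, then the differential equation $$X'=(a_2+a_3\xi)\beta+2\left(a_1\xi+\frac{\beta'}{4\beta}\right)X-(a_2-a_3\xi)X^2$$ has at least two distinct solutions in $L$. (b) If the differential equation in (a) has at least two distinct solutions, say $\lambda_1,\lambda_2$, in $L$, then $(Q,d)$ is split by a simple differential field extension $(L(\mu),\,')$ of $(L,\,')$, where $\mu$ is a (nonzero) solution of the differential equation $$\frac{Y'}{Y}=(a_2-a_3\xi)\lambda_1-\left(a_1\xi+\frac{\beta'}{4\beta}\right).$$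
   Context: A derivation on a ring $R$ is an additive map $d$ with $d(xy)=xd(y)+d(x)y$; a differential field $(k,\,')$ is a field with a derivation $'$, and a differential field extension is a field extension with a derivation restricting to the given one. $\overline{k}$ is an algebraic closure of $k$. The field $k(\xi)$ carries the unique derivation extending $'$. For $Q=(\alpha,\beta)_k$ with generators $u,v$, $d_{(u,v)}$ is the unique derivation on $Q$ extending $'$ with $d_{(u,v)}(u)\in k(u)$ and $d_{(u,v)}(v)\in k(v)$; explicitly $d_{(u,v)}(u)=\frac{\alpha'}{2\alpha}u$ and $d_{(u,v)}(v)=\frac{\beta'}{2\beta}v$. For $\vartheta\in Q$, $\partial_\vartheta(x)=x\vartheta-\vartheta x$. Every derivation $d$ on $Q$ extending $'$ can be written uniquely as $d=d_{(u,v)}+\partial_\vartheta$ with $\vartheta\in Q^0:=ku+kv+kuv$. $(Q,d)$ is split by a differential field extension $(L,\,')$ of $(k,\,')$ if there is an $L$-algebra isomorphism $\phi:Q\otimes_kL\to M_2(L)$ with $\phi\circ d^*=\,'\circ\phi$, where $d^*=d\otimes \mathrm{id}_L+\mathrm{id}_Q\otimes\,'$ and $'$ on $M_2(L)$ is the coordinate-wise derivation $(a_{ij})'=(a_{ij}')$. *)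

theory Defs
  imports
    "HOL-Algebra.Algebraic_Closure_Type"
    "HOL-Algebra.Generated_Fields"
    "HOL-Algebra.QuotRing"
    "HOL-Algebra.Module"
    "HOL-Analysis.Finite_Cartesian_Product"
    "HOL-Library.Poly_Mapping"
    "HOL-Computational_Algebra.Fraction_Field"
begin

section \<open>Differential rings and fields\<close>

text \<open>The carrier set is explicit because \<open>k(\<xi>)\<close> is a subfield of the type
  \<open>'k alg_closure\<close>.\<close>

definition derivation_on :: "'a::ring set \<Rightarrow> ('a \<Rightarrow> 'a) \<Rightarrow> bool" where
  "derivation_on K D \<longleftrightarrow>
     (\<forall>x\<in>K. D x \<in> K) \<and>
     (\<forall>x\<in>K. \<forall>y\<in>K. D (x + y) = D x + D y) \<and>
     (\<forall>x\<in>K. \<forall>y\<in>K. D (x * y) = x * D y + D x * y)"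

abbreviation derivation :: "('a::ring \<Rightarrow> 'a) \<Rightarrow> bool" where
  "derivation D \<equiv> derivation_on UNIV D"

text \<open>The whole type \<open>'b\<close> with derivation \<open>E\<close> is a differential field extension, along the
  embedding \<open>j\<close>, of the differential field \<open>(K, D)\<close>; here \<open>K\<close> is meant to be a subfield of
  \<open>'a\<close>. Values of \<open>j\<close> and \<open>D\<close> outside \<open>K\<close> are irrelevant. Injectivity of \<open>j\<close> on \<open>K\<close> is
  automatic.\<close>

definition diff_field_extension ::
    "'a::field set \<Rightarrow> ('a \<Rightarrow> 'a) \<Rightarrow> ('a \<Rightarrow> 'b::field) \<Rightarrow> ('b \<Rightarrow> 'b) \<Rightarrow> bool" where
  "diff_field_extension K D j E \<longleftrightarrow>
     derivation_on K D \<and> derivation E \<and>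
     j 1 = 1 \<and>
     (\<forall>x\<in>K. \<forall>y\<in>K. j (x + y) = j x + j y) \<and>
     (\<forall>x\<in>K. \<forall>y\<in>K. j (x * y) = j x * j y) \<and>
     (\<forall>x\<in>K. j (D x) = E (j x))"

text \<open>The subfield generated by a set.\<close>

abbreviation field_gen :: "'a::field set \<Rightarrow> 'a set" where
  "field_gen S \<equiv> generate_field ring_of_type_algebra S"


text \<open>\<open>('m, F)\<close> is a simple differential field extension \<open>L(\<mu>)\<close> of \<open>L = ('l, E)\<close> along \<open>\<kappa>\<close>,
  where \<open>\<mu>\<close> is a nonzero solution of \<open>Y'/Y = g\<close>. Existence of such an extension is stated
  over the type \<open>'l poly fract\<close>, because HOL cannot quantify existentially over types: that
  type has room for a transcendental \<open>\<mu>\<close>, for which the equation can always be imposed. The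
  embedding, the derivation and \<open>\<mu>\<close> itself remain existentially quantified.\<close>

definition exponential_extension ::
    "('l::field \<Rightarrow> 'l) \<Rightarrow> ('l \<Rightarrow> 'm::field) \<Rightarrow> ('m \<Rightarrow> 'm) \<Rightarrow> 'm \<Rightarrow> 'l \<Rightarrow> bool" where
  "exponential_extension E \<kappa> F \<mu> g \<longleftrightarrow>
     diff_field_extension UNIV E \<kappa> F \<and>
     field_gen (insert \<mu> (range \<kappa>)) = UNIV \<and>
     \<mu> \<noteq> 0 \<and> F \<mu> / \<mu> = \<kappa> g"


section \<open>Algebras over a field, quaternion algebras\<close>

locale algebra_over = vector_space smul
  for smul :: "'k::field \<Rightarrow> 'q::ring_1 \<Rightarrow> 'q" +
  assumes smul_mult_left: "smul c x * y = smul c (x * y)"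
    and smul_mult_right: "x * smul c y = smul c (x * y)"

locale quaternion_algebra = algebra_over smul
  for smul :: "'k::field \<Rightarrow> 'q::ring_1 \<Rightarrow> 'q" +
  fixes \<alpha> \<beta> :: 'k and u v :: 'q
  assumes \<alpha>_nonzero: "\<alpha> \<noteq> 0" and \<beta>_nonzero: "\<beta> \<noteq> 0"
    and u_square: "u * u = smul \<alpha> 1"
    and v_square: "v * v = smul \<beta> 1"
    and anticommute: "v * u = - (u * v)"
    and basis_distinct: "distinct [1, u, v, u * v]"
    and basis_independent: "independent {1, u, v, u * v}"
    and basis_span: "span {1, u, v, u * v} = UNIV"

definition derivation_extending ::
    "('k::field \<Rightarrow> 'q::ring_1 \<Rightarrow> 'q) \<Rightarrow> ('k \<Rightarrow> 'k) \<Rightarrow> ('q \<Rightarrow> 'q) \<Rightarrow> bool" where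
  "derivation_extending smul \<delta> d \<longleftrightarrow>
     derivation d \<and> (\<forall>c. d (smul c 1) = smul (\<delta> c) 1)"

text \<open>The property characterising \<open>d\<^bsub>(u,v)\<^esub>\<close>. As \<open>u\<^sup>2\<close> and \<open>v\<^sup>2\<close> are scalars, the subalgebra
  \<open>k(u)\<close> is \<open>k + ku\<close>, and \<open>k(v)\<close> is \<open>k + kv\<close>.\<close>

definition standard_derivation ::
    "('k::field \<Rightarrow> 'q::ring_1 \<Rightarrow> 'q) \<Rightarrow> ('k \<Rightarrow> 'k) \<Rightarrow> 'q \<Rightarrow> 'q \<Rightarrow> ('q \<Rightarrow> 'q) \<Rightarrow> bool" where
  "standard_derivation smul \<delta> u v d \<longleftrightarrow>
     derivation_extending smul \<delta> d \<and>
     (\<exists>a b. d u = smul a 1 + smul b u) \<and>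
     (\<exists>a b. d v = smul a 1 + smul b v)"

definition inner_derivation :: "'q::ring_1 \<Rightarrow> 'q \<Rightarrow> 'q" where
  "inner_derivation \<theta> x = x * \<theta> - \<theta> * x"


section \<open>The tensor product \<open>Q \<otimes>\<^sub>k L\<close>\<close>

text \<open>\<open>L\<close> is a \<open>k\<close>-algebra through a field embedding \<open>\<iota>\<close>. The tensor product is the free abelian
  group on \<open>Q \<times> L\<close> (formal integer combinations of pairs, each pair given by \<open>frag_of\<close>) modulo
  the following subgroup.\<close>

inductive_set tensor_null ::
    "('k::field \<Rightarrow> 'q::ring_1 \<Rightarrow> 'q) \<Rightarrow> ('k \<Rightarrow> 'l::field) \<Rightarrow> ('q \<times> 'l \<Rightarrow>\<^sub>0 int) set"
  for smul :: "'k::field \<Rightarrow> 'q::ring_1 \<Rightarrow> 'q" and \<iota> :: "'k \<Rightarrow> 'l::field" where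
  add_left: "frag_of (x + y, a) - frag_of (x, a) - frag_of (y, a) \<in> tensor_null smul \<iota>"
| add_right: "frag_of (x, a + b) - frag_of (x, a) - frag_of (x, b) \<in> tensor_null smul \<iota>"
| balanced: "frag_of (smul c x, a) - frag_of (x, \<iota> c * a) \<in> tensor_null smul \<iota>"
| zero: "0 \<in> tensor_null smul \<iota>"
| diff: "f \<in> tensor_null smul \<iota> \<Longrightarrow> g \<in> tensor_null smul \<iota> \<Longrightarrow> f - g \<in> tensor_null smul \<iota>"

definition tensor_class ::
    "('k::field \<Rightarrow> 'q::ring_1 \<Rightarrow> 'q) \<Rightarrow> ('k \<Rightarrow> 'l::field) \<Rightarrow> ('q \<times> 'l \<Rightarrow>\<^sub>0 int) \<Rightarrow> ('q \<times> 'l \<Rightarrow>\<^sub>0 int) set"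
  where "tensor_class smul \<iota> f = {g. g - f \<in> tensor_null smul \<iota>}"

definition formal_mult ::
    "('q::ring_1 \<times> 'l::field \<Rightarrow>\<^sub>0 int) \<Rightarrow> ('q \<times> 'l \<Rightarrow>\<^sub>0 int) \<Rightarrow> ('q \<times> 'l \<Rightarrow>\<^sub>0 int)" where
  "formal_mult f g =
     frag_extend (\<lambda>(x, a). frag_extend (\<lambda>(y, b). frag_of (x * y, a * b)) g) f"

definition formal_smult ::
    "'l::field \<Rightarrow> ('q::ring_1 \<times> 'l \<Rightarrow>\<^sub>0 int) \<Rightarrow> ('q \<times> 'l \<Rightarrow>\<^sub>0 int)" where
  "formal_smult c = frag_extend (\<lambda>(x, a). frag_of (x, c * a))"

definition formal_deriv ::
    "('q::ring_1 \<Rightarrow> 'q) \<Rightarrow> ('l::field \<Rightarrow> 'l) \<Rightarrow> ('q \<times> 'l \<Rightarrow>\<^sub>0 int) \<Rightarrow> ('q \<times> 'l \<Rightarrow>\<^sub>0 int)" where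
  "formal_deriv d E = frag_extend (\<lambda>(x, a). frag_of (d x, a) + frag_of (x, E a))"

text \<open>The \<open>L\<close>-algebra \<open>Q \<otimes>\<^sub>k L\<close>. Operations on classes are given by operations on
  representatives; the unions are over equal sets, see \<open>tensor_add_class\<close> etc. below.\<close>

definition tensor_algebra ::
    "('k::field \<Rightarrow> 'q::ring_1 \<Rightarrow> 'q) \<Rightarrow> ('k \<Rightarrow> 'l::field) \<Rightarrow> ('l, ('q \<times> 'l \<Rightarrow>\<^sub>0 int) set) module" where
  "tensor_algebra smul \<iota> =
    \<lparr>carrier = range (tensor_class smul \<iota>),
     monoid.mult = (\<lambda>A B. \<Union>f\<in>A. \<Union>g\<in>B. tensor_class smul \<iota> (formal_mult f g)),
     one = tensor_class smul \<iota> (frag_of (1, 1)),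
     ring.zero = tensor_class smul \<iota> 0,
     add = (\<lambda>A B. \<Union>f\<in>A. \<Union>g\<in>B. tensor_class smul \<iota> (f + g)),
     module.smult = (\<lambda>c A. \<Union>f\<in>A. tensor_class smul \<iota> (formal_smult c f))\<rparr>"

text \<open>\<open>d\<^sup>* = d \<otimes> id + id \<otimes> E\<close>\<close>

definition tensor_deriv ::
    "('k::field \<Rightarrow> 'q::ring_1 \<Rightarrow> 'q) \<Rightarrow> ('k \<Rightarrow> 'l::field) \<Rightarrow> ('q \<Rightarrow> 'q) \<Rightarrow> ('l \<Rightarrow> 'l) \<Rightarrow>
      ('q \<times> 'l \<Rightarrow>\<^sub>0 int) set \<Rightarrow> ('q \<times> 'l \<Rightarrow>\<^sub>0 int) set" where
  "tensor_deriv smul \<iota> d E A = (\<Union>f\<in>A. tensor_class smul \<iota> (formal_deriv d E f))"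


section \<open>Splitting\<close>

definition matrix_algebra :: "('l::field, 'l^2^2) module" where
  "matrix_algebra =
    \<lparr>carrier = UNIV, monoid.mult = (\<lambda>A B. A ** B), one = mat 1, ring.zero = 0, add = (+),
     module.smult = (\<lambda>c A. \<chi> i j. c * A $ i $ j)\<rparr>"

definition matrix_deriv :: "('l::field \<Rightarrow> 'l) \<Rightarrow> 'l^2^2 \<Rightarrow> 'l^2^2" where
  "matrix_deriv E A = (\<chi> i j. E (A $ i $ j))"

definition algebra_iso ::
    "('l, 'a, 'm) module_scheme \<Rightarrow> ('l, 'b, 'n) module_scheme \<Rightarrow> ('a \<Rightarrow> 'b) set" where
  "algebra_iso A B =
     {\<phi> \<in> ring_iso A B. \<forall>c. \<forall>x\<in>carrier A. \<phi> (c \<odot>\<^bsub>A\<^esub> x) = c \<odot>\<^bsub>B\<^esub> \<phi> x}"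

text \<open>\<open>(Q, d)\<close> is split by \<open>('l, E)\<close>, an extension of the base field along \<open>\<iota>\<close>.\<close>

definition split_by ::
    "('k::field \<Rightarrow> 'q::ring_1 \<Rightarrow> 'q) \<Rightarrow> ('q \<Rightarrow> 'q) \<Rightarrow> ('k \<Rightarrow> 'l::field) \<Rightarrow> ('l \<Rightarrow> 'l) \<Rightarrow> bool" where
  "split_by smul d \<iota> E \<longleftrightarrow>
     (\<exists>\<phi> \<in> algebra_iso (tensor_algebra smul \<iota>) matrix_algebra.
        \<forall>t \<in> carrier (tensor_algebra smul \<iota>).
          \<phi> (tensor_deriv smul \<iota> d E t) = matrix_deriv E (\<phi> t))"


section \<open>Well-definedness of the tensor product operations\<close>

lemma tensor_null_uminus: "f \<in> tensor_null s \<iota> \<Longrightarrow> - f \<in> tensor_null s \<iota>"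
  using tensor_null.diff[OF tensor_null.zero, of f s \<iota>] by simp

lemma tensor_null_add:
  "f \<in> tensor_null s \<iota> \<Longrightarrow> g \<in> tensor_null s \<iota> \<Longrightarrow> f + g \<in> tensor_null s \<iota>"
  using tensor_null.diff[OF _ tensor_null_uminus, of f s \<iota> g] by simp

lemma tensor_class_eq_iff:
  "tensor_class s \<iota> f = tensor_class s \<iota> g \<longleftrightarrow> f - g \<in> tensor_null s \<iota>"
proof
  assume "tensor_class s \<iota> f = tensor_class s \<iota> g"
  moreover have "f \<in> tensor_class s \<iota> f"
    by (simp add: tensor_class_def tensor_null.zero)
  ultimately show "f - g \<in> tensor_null s \<iota>"
    by (simp add: tensor_class_def)
next
  assume fg: "f - g \<in> tensor_null s \<iota>"
  have "h - g \<in> tensor_null s \<iota>" if "h - f \<in> tensor_null s \<iota>" for h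
    using tensor_null_add[OF that fg] by simp
  moreover have "h - f \<in> tensor_null s \<iota>" if "h - g \<in> tensor_null s \<iota>" for h
    using tensor_null.diff[OF that fg] by simp
  ultimately show "tensor_class s \<iota> f = tensor_class s \<iota> g"
    by (auto simp: tensor_class_def)
qed

lemma tensor_class_self: "f \<in> tensor_class s \<iota> f"
  by (simp add: tensor_class_def tensor_null.zero)

lemma tensor_class_nonempty: "tensor_class s \<iota> f \<noteq> {}"
  using tensor_class_self by blast

lemma tensor_add_class:
  "tensor_class s \<iota> f \<oplus>\<^bsub>tensor_algebra s \<iota>\<^esub> tensor_class s \<iota> g = tensor_class s \<iota> (f + g)"
proof -
  have "tensor_class s \<iota> (f' + g') = tensor_class s \<iota> (f + g)"
    if "f' \<in> tensor_class s \<iota> f" "g' \<in> tensor_class s \<iota> g" for f' g'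
    using tensor_null_add[of "f' - f" s \<iota> "g' - g"] that
    unfolding tensor_class_eq_iff by (simp add: tensor_class_def algebra_simps)
  then show ?thesis
    by (simp add: tensor_algebra_def tensor_class_nonempty)
qed

lemma frag_extend_tensor_null:
  assumes "f \<in> tensor_null s \<iota>"
    and "\<And>x y a. h (x + y, a) - h (x, a) - h (y, a) \<in> tensor_null s \<iota>"
    and "\<And>x a b. h (x, a + b) - h (x, a) - h (x, b) \<in> tensor_null s \<iota>"
    and "\<And>c x a. h (s c x, a) - h (x, \<iota> c * a) \<in> tensor_null s \<iota>"
  shows "frag_extend h f \<in> tensor_null s \<iota>"
  using assms(1)
  by induction (simp_all add: frag_extend_diff assms(2-) tensor_null.zero tensor_null.diff)

lemma tensor_lift_class:
  assumes "\<And>f. f \<in> tensor_null s \<iota> \<Longrightarrow> frag_extend h f \<in> tensor_null s \<iota>"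
  shows "(\<Union>g\<in>tensor_class s \<iota> f. tensor_class s \<iota> (frag_extend h g))
           = tensor_class s \<iota> (frag_extend h f)"
proof -
  have "tensor_class s \<iota> (frag_extend h g) = tensor_class s \<iota> (frag_extend h f)"
    if "g \<in> tensor_class s \<iota> f" for g
    using assms[of "g - f"] that
    unfolding tensor_class_eq_iff by (simp add: tensor_class_def frag_extend_diff)
  then show ?thesis
    by (simp add: tensor_class_nonempty)
qed

lemma tensor_smult_class:
  "c \<odot>\<^bsub>tensor_algebra s \<iota>\<^esub> tensor_class s \<iota> f = tensor_class s \<iota> (formal_smult c f)"
proof -
  have *: "frag_of (x, c * (a + b)) - frag_of (x, c * a) - frag_of (x, c * b) \<in> tensor_null s \<iota>"
    for x a b using tensor_null.add_right[where a = "c * a" and b = "c * b"] by (simp add: distrib_left)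
  have **: "frag_of (s r x, c * a) - frag_of (x, c * (\<iota> r * a)) \<in> tensor_null s \<iota>" for x a r
    using tensor_null.balanced[where a = "c * a" and x = x and c = r] by (simp add: mult.left_commute)
  have "frag_extend (\<lambda>(x, a). frag_of (x, c * a)) f \<in> tensor_null s \<iota>"
    if "f \<in> tensor_null s \<iota>" for f
    by (rule frag_extend_tensor_null[OF that]) (simp_all add: * ** tensor_null.add_left)
  from tensor_lift_class[OF this, of f] show ?thesis
    by (simp add: tensor_algebra_def formal_smult_def)
qed

lemma frag_extend_null:
  assumes "\<And>p. h p \<in> tensor_null s \<iota>"
  shows "frag_extend h g \<in> tensor_null s \<iota>"
proof -
  have "Poly_Mapping.keys g \<subseteq> UNIV" by simp
  then show ?thesis
    by (induction rule: frag_induction)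
      (simp_all add: assms tensor_null.zero tensor_null.diff frag_extend_diff)
qed

lemma frag_extend_fun_diff: "frag_extend (\<lambda>p. h p - k p) g = frag_extend h g - frag_extend k g"
proof -
  have "frag_cmul c (x - y) = frag_cmul c x - frag_cmul c y" for c and x y :: "'a \<Rightarrow>\<^sub>0 int"
    by (rule poly_mapping_eqI) (simp add: lookup_minus right_diff_distrib)
  then show ?thesis
    by (simp add: frag_extend_def sum_subtractf)
qed

lemma tensor_mult_class:
  assumes "algebra_over s"
  shows "tensor_class s \<iota> f \<otimes>\<^bsub>tensor_algebra s \<iota>\<^esub> tensor_class s \<iota> g
           = tensor_class s \<iota> (formal_mult f g)"
proof -
  interpret algebra_over s by fact
  let ?h = "\<lambda>g (x, a). frag_extend (\<lambda>(y, b). frag_of (x * y, a * b)) g"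
  have l: "formal_mult f g \<in> tensor_null s \<iota>" if "f \<in> tensor_null s \<iota>" for f g
    unfolding formal_mult_def
  proof (rule frag_extend_tensor_null[OF that])
    show "?h g (x + y, a) - ?h g (x, a) - ?h g (y, a) \<in> tensor_null s \<iota>" for x y a
      unfolding prod.case frag_extend_fun_diff[symmetric]
      by (rule frag_extend_null) (auto simp: distrib_right intro: tensor_null.add_left)
    show "?h g (x, a + b) - ?h g (x, a) - ?h g (x, b) \<in> tensor_null s \<iota>" for x a b
      unfolding prod.case frag_extend_fun_diff[symmetric]
      by (rule frag_extend_null) (auto simp: distrib_right intro: tensor_null.add_right)
    show "?h g (s c x, a) - ?h g (x, \<iota> c * a) \<in> tensor_null s \<iota>" for c x a
      unfolding prod.case frag_extend_fun_diff[symmetric]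
      by (rule frag_extend_null)
        (auto simp: smul_mult_left mult.assoc intro: tensor_null.balanced)
  qed
  have r: "formal_mult f g \<in> tensor_null s \<iota>" if "g \<in> tensor_null s \<iota>" for f g
    unfolding formal_mult_def
  proof (rule frag_extend_null, clarify, rule frag_extend_tensor_null[OF that], unfold prod.case)
    show "frag_of (p * (x + y), q * a) - frag_of (p * x, q * a) - frag_of (p * y, q * a)
            \<in> tensor_null s \<iota>" for p q x y a
      unfolding distrib_left by (rule tensor_null.add_left)
    show "frag_of (p * x, q * (a + b)) - frag_of (p * x, q * a) - frag_of (p * x, q * b)
            \<in> tensor_null s \<iota>" for p q x a b
      unfolding distrib_left by (rule tensor_null.add_right)
    show "frag_of (p * s c x, q * a) - frag_of (p * x, q * (\<iota> c * a)) \<in> tensor_null s \<iota>"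
      for p q c x a
      using tensor_null.balanced[where a = "q * a" and x = "p * x" and c = c]
      by (simp add: smul_mult_right mult.left_commute)
  qed
  have diff_l: "formal_mult (f' - f) g = formal_mult f' g - formal_mult f g" for f f' g
    by (simp add: formal_mult_def frag_extend_diff)
  have diff_r: "formal_mult f (g' - g) = formal_mult f g' - formal_mult f g" for f g g'
  proof -
    have "(\<lambda>(x, a). frag_extend (\<lambda>(y, b). frag_of (x * y, a * b)) (g' - g))
            = (\<lambda>p. ?h g' p - ?h g p)"
      by (auto simp: frag_extend_diff)
    then show ?thesis
      by (simp add: formal_mult_def frag_extend_fun_diff)
  qed
  have "tensor_class s \<iota> (formal_mult f' g') = tensor_class s \<iota> (formal_mult f g)"
    if "f' \<in> tensor_class s \<iota> f" "g' \<in> tensor_class s \<iota> g" for f' g'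
  proof -
    have "formal_mult (f' - f) g' + formal_mult f (g' - g) \<in> tensor_null s \<iota>"
      using that by (intro tensor_null_add l r) (simp_all add: tensor_class_def)
    then show ?thesis
      by (simp add: tensor_class_eq_iff diff_l diff_r)
  qed
  then show ?thesis
    by (simp add: tensor_algebra_def tensor_class_nonempty)
qed

lemma tensor_deriv_class:
  fixes E :: "'l::field \<Rightarrow> 'l"
  assumes "algebra_over s" and "derivation_extending s \<delta> d" and "derivation E"
    and "\<And>c. E (\<iota> c) = \<iota> (\<delta> c)"
  shows "tensor_deriv s \<iota> d E (tensor_class s \<iota> f) = tensor_class s \<iota> (formal_deriv d E f)"
proof -
  interpret algebra_over s by fact
  have d_add: "d (x + y) = d x + d y" for x y
    using assms(2) by (simp add: derivation_extending_def derivation_on_def)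
  have E_add: "E (x + y) = E x + E y" and E_mult: "E (x * y) = x * E y + E x * y" for x y
    using assms(3) by (simp_all add: derivation_on_def)
  have d_smul: "d (s c x) = s c (d x) + s (\<delta> c) x" for c x
  proof -
    have "d (s c 1 * x) = s c 1 * d x + d (s c 1) * x"
      using assms(2) by (simp add: derivation_extending_def derivation_on_def)
    then show ?thesis
      using assms(2) by (simp add: derivation_extending_def smul_mult_left)
  qed
  let ?h = "\<lambda>(x, a). frag_of (d x, a) + frag_of (x, E a)"
  have "frag_extend ?h f \<in> tensor_null s \<iota>" if "f \<in> tensor_null s \<iota>" for f
  proof (rule frag_extend_tensor_null[OF that])
    show "?h (x + y, a) - ?h (x, a) - ?h (y, a) \<in> tensor_null s \<iota>" for x y a
      using tensor_null_add[OF tensor_null.add_left[where x = "d x" and y = "d y" and a = a]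
          tensor_null.add_left[where x = x and y = y and a = "E a"]]
      by (simp add: d_add algebra_simps)
    show "?h (x, a + b) - ?h (x, a) - ?h (x, b) \<in> tensor_null s \<iota>" for x a b
      using tensor_null_add[OF tensor_null.add_right[where x = "d x" and a = a and b = b]
          tensor_null.add_right[where x = x and a = "E a" and b = "E b"]]
      by (simp add: E_add algebra_simps)
    show "?h (s c x, a) - ?h (x, \<iota> c * a) \<in> tensor_null s \<iota>" for c x a
    proof -
      let ?r1 = "frag_of (s c (d x) + s (\<delta> c) x, a) - frag_of (s c (d x), a) - frag_of (s (\<delta> c) x, a)"
      let ?r2 = "frag_of (s c (d x), a) - frag_of (d x, \<iota> c * a)"
      let ?r3 = "frag_of (s (\<delta> c) x, a) - frag_of (x, \<iota> (\<delta> c) * a)"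
      let ?r4 = "frag_of (s c x, E a) - frag_of (x, \<iota> c * E a)"
      let ?r5 = "frag_of (x, \<iota> c * E a + \<iota> (\<delta> c) * a) - frag_of (x, \<iota> c * E a)
                   - frag_of (x, \<iota> (\<delta> c) * a)"
      have "?r1 + ?r2 + ?r3 + ?r4 - ?r5 \<in> tensor_null s \<iota>"
        by (intro tensor_null_add tensor_null.diff tensor_null.add_left tensor_null.add_right
            tensor_null.balanced)
      then show ?thesis
        by (simp add: d_smul E_mult assms(4) algebra_simps)
    qed
  qed
  from tensor_lift_class[OF this, of f] show ?thesis
    by (simp add: tensor_deriv_def formal_deriv_def)
qed

end

theory Submission
  imports Defs "HOL-Analysis.Cartesian_Space" "HOL-Computational_Algebra.Polynomial_Factorial"
begin

text \<open>
  Write \<open>c\<^sub>1 = a2 + a3 \<xi>\<close>, \<open>c\<^sub>2 = a2 - a3 \<xi>\<close> and \<open>m = a1 \<xi> + \<beta>' / (4 \<beta>)\<close> (below: \<open>c_plus\<close>,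
  \<open>c_minus\<close>, \<open>m\<close>), so that the equation reads \<open>X' = c\<^sub>1 \<beta> + 2 m X - c\<^sub>2 X\<^sup>2\<close>. The idea is that it is the
  projectivisation of a linear differential system whose invertible solutions are exactly the
  splittings of the algebra.

  A splitting amounts to a multiplicative map \<open>\<psi>\<close> from \<open>Q\<close> to the \<open>2 \<times> 2\<close> matrices that is
  semilinear over the embedding of \<open>k\<close> and satisfies \<open>\<psi> (d x) = (\<psi> x)'\<close>: restrict an isomorphism to
  \<open>Q \<otimes> 1\<close> (\<open>split_imp_representation\<close>) or extend \<open>\<psi>\<close> by linearity
  (\<open>representation_imp_split\<close>). Under such a \<open>\<psi>\<close>, the image of \<open>u\<close> has eigenvalues \<open>\<xi>\<close> and \<open>- \<xi>\<close>. If
  \<open>e\<close> is an eigenvector for \<open>\<xi>\<close>, then \<open>f = \<psi> v e\<close> is one for \<open>- \<xi>\<close>, and \<open>\<psi> v f = \<beta> e\<close>.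
  Differentiating these relations and using the known values of \<open>d u\<close> and \<open>d v\<close> gives
  \<open>e' = p e - c\<^sub>2 f\<close> and \<open>f' = (p + 2 m) f - c\<^sub>1 \<beta> e\<close> for some scalar \<open>p\<close>, which is called a
  differential frame below. Conversely, let \<open>A\<close> be the matrix with columns \<open>e\<close> and \<open>f\<close>, that is, an
  invertible solution of \<open>A' = A P\<close> with \<open>P\<close> read off from these equations. On the matrix algebra
  obtained from the standard representation (\<open>u\<close> diagonal), \<open>d\<close> becomes \<open>X \<mapsto> X' + P X - X P\<close>, and
  conjugation by \<open>A\<close> turns this into the entrywise derivation. So splittings correspond to
  differential frames (\<open>split_imp_differential_frame\<close>, \<open>differential_frame_imp_split\<close>).

  Each row \<open>(x, y)\<close> of \<open>A\<close> solves \<open>x' = p x - c\<^sub>2 y\<close>, \<open>y' = (p + 2 m) y - c\<^sub>1 \<beta> x\<close>, and then \<open>- y / x\<close>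
  solves the Riccati equation whenever \<open>x\<close> is nonzero. The two independent rows, after adding one to
  the other if \<open>x\<close> vanishes in one of them, give two distinct solutions: this is (a). For (b) the rows
  have to be recovered from the ratios \<open>\<lambda>\<^sub>1\<close> and \<open>\<lambda>\<^sub>2\<close>. Taking \<open>p = - m\<close>, a row \<open>(x, - \<lambda>\<^sub>i x)\<close> works
  precisely if \<open>x' / x = c\<^sub>2 \<lambda>\<^sub>i - m\<close>. For \<open>i = 1\<close> this is the equation for \<open>\<mu>\<close>, and for \<open>i = 2\<close> no
  further extension is necessary, since subtracting the two Riccati equations shows that
  \<open>1 / (\<mu> (\<lambda>\<^sub>1 - \<lambda>\<^sub>2))\<close> is a solution. An extension containing such a \<open>\<mu>\<close> always exists: take a transcendental
  \<open>\<mu>\<close>, extend the derivation to polynomials in \<open>\<mu>\<close> by prescribing \<open>\<mu>'\<close>, and then to fractions by the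
  quotient rule (\<open>exponential_extension_exists\<close>).
\<close>

(* This infix would make the entry notation for vectors and matrices ambiguous. *)
no_notation fps_nth (infixl \<open>$\<close> 75)

section \<open>Derivations\<close>

lemma derivation_zero: "derivation D \<Longrightarrow> D 0 = 0"
  unfolding derivation_on_def by (metis UNIV_I add_cancel_right_left)

lemma derivation_add: "derivation D \<Longrightarrow> D (x + y) = D x + D y"
  by (simp add: derivation_on_def)

lemma derivation_mult: "derivation D \<Longrightarrow> D (x * y) = x * D y + D x * y"
  by (simp add: derivation_on_def)

lemma derivation_one:
  fixes D :: "'a::ring_1 \<Rightarrow> 'a"
  assumes "derivation D"
  shows "D 1 = 0"
  using derivation_mult[OF assms, of 1 1] by simp

lemma derivation_minus: "derivation D \<Longrightarrow> D (- x) = - D x"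
  by (metis add.right_inverse derivation_add derivation_zero minus_unique)

lemma derivation_diff: "derivation D \<Longrightarrow> D (x - y) = D x - D y"
  using derivation_add[of D x "- y"] by (simp add: derivation_minus)

lemma derivation_sum: "derivation D \<Longrightarrow> D (\<Sum>i\<in>A. f i) = (\<Sum>i\<in>A. D (f i))"
  by (induction A rule: infinite_finite_induct) (simp_all add: derivation_zero derivation_add)

lemma derivation_inverse_exponential:
  fixes D :: "'a::field \<Rightarrow> 'a"
  assumes "derivation D" "y \<noteq> 0" "D y = g * y"
  shows "D (inverse y) = - g * inverse y"
proof -
  have "y * D (inverse y) + D y * inverse y = 0"
    using derivation_mult[OF assms(1), of y "inverse y"] assms(2) derivation_one[OF assms(1)]
    by simp
  then have "y * (D (inverse y) + g * inverse y) = 0"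
    unfolding assms(3) by (simp add: algebra_simps)
  then show ?thesis
    using assms(2) by (simp add: eq_neg_iff_add_eq_0)
qed

section \<open>Adjoining an exponential to a differential field\<close>

lemma derivation_map_poly:
  fixes E :: "'a::comm_ring_1 \<Rightarrow> 'a"
  assumes "derivation E"
  shows "derivation (map_poly E)"
proof -
  note E = derivation_zero[OF assms] derivation_add[OF assms] derivation_mult[OF assms]
    derivation_sum[OF assms]
  have "map_poly E (p + q) = map_poly E p + map_poly E q" for p q
    by (rule poly_eqI) (simp add: coeff_map_poly E)
  moreover have "map_poly E (p * q) = p * map_poly E q + map_poly E p * q" for p q
    by (rule poly_eqI) (simp add: coeff_map_poly E coeff_mult sum.distrib)
  ultimately show ?thesis
    by (simp add: derivation_on_def)
qed

text \<open>The derivation of the polynomial ring that restricts to \<open>E\<close> on constants and sends the variable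
  to \<open>g\<close> times itself.\<close>

definition exponential_poly_deriv :: "('a::idom \<Rightarrow> 'a) \<Rightarrow> 'a \<Rightarrow> 'a poly \<Rightarrow> 'a poly" where
  "exponential_poly_deriv E g p = map_poly E p + [:0, g:] * pderiv p"

lemma derivation_exponential_poly_deriv:
  assumes "derivation E"
  shows "derivation (exponential_poly_deriv E g)"
  using derivation_map_poly[OF assms]
  by (simp add: derivation_on_def exponential_poly_deriv_def pderiv_add pderiv_mult algebra_simps)

text \<open>The quotient rule. A representing pair has to be chosen because the fraction field has no canonical
  numerators and denominators; \<open>fract_deriv_Fract\<close> shows that the choice does not matter.\<close>

definition fract_deriv :: "('a::idom \<Rightarrow> 'a) \<Rightarrow> 'a fract \<Rightarrow> 'a fract" where
  "fract_deriv G q =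
     (case SOME (a, b). b \<noteq> 0 \<and> q = Fract a b of (a, b) \<Rightarrow> Fract (b * G a - a * G b) (b * b))"

lemma fract_deriv_Fract:
  fixes G :: "'a::idom \<Rightarrow> 'a"
  assumes G: "derivation G" and b: "b \<noteq> 0"
  shows "fract_deriv G (Fract a b) = Fract (b * G a - a * G b) (b * b)"
proof -
  let ?P = "\<lambda>(a', b'). b' \<noteq> 0 \<and> Fract a b = Fract a' b'"
  obtain a' b' where ab': "(SOME p. ?P p) = (a', b')" by fastforce
  have "?P (SOME p. ?P p)"
    by (rule someI[of _ "(a, b)"]) (simp add: b)
  then have b': "b' \<noteq> 0" and "Fract a b = Fract a' b'"
    unfolding ab' by auto
  then have eq: "a * b' = a' * b"
    using b by (simp add: eq_fract)
  have "G (a * b') = G (a' * b)" by (simp add: eq)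
  then have Geq: "a * G b' + G a * b' = a' * G b + G a' * b"
    by (simp add: derivation_mult[OF G])
  \<comment> \<open>Both summands vanish: the first by differentiating \<open>a b' = a' b\<close>, the second by that equation.\<close>
  have "(b' * G a' - a' * G b') * (b * b) - (b * G a - a * G b) * (b' * b')
        = b * b' * ((a' * G b + G a' * b) - (a * G b' + G a * b'))
          + (a * b' - a' * b) * (b' * G b + b * G b')"
    by (simp add: algebra_simps)
  also have "\<dots> = 0"
    by (simp add: eq Geq)
  finally have "Fract (b' * G a' - a' * G b') (b' * b') = Fract (b * G a - a * G b) (b * b)"
    using b b' by (simp add: eq_fract)
  then show ?thesis
    by (simp add: fract_deriv_def ab')
qed

lemma derivation_fract_deriv:
  fixes G :: "'a::idom \<Rightarrow> 'a"
  assumes G: "derivation G"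
  shows "derivation (fract_deriv G)"
proof -
  have "fract_deriv G (x + y) = fract_deriv G x + fract_deriv G y
        \<and> fract_deriv G (x * y) = x * fract_deriv G y + fract_deriv G x * y" for x y
    by (cases x; cases y)
      (simp add: fract_deriv_Fract[OF G] derivation_add[OF G] derivation_mult[OF G] eq_fract
         algebra_simps)
  then show ?thesis
    by (simp add: derivation_on_def)
qed

lemma fract_deriv_to_fract:
  assumes "derivation G"
  shows "fract_deriv G (to_fract p) = to_fract (G p)"
  by (simp add: to_fract_def fract_deriv_Fract[OF assms] derivation_one[OF assms])

lemma field_gen_incl: "x \<in> S \<Longrightarrow> x \<in> field_gen S"
  by (rule generate_field.incl)

lemma field_gen_add: "x \<in> field_gen S \<Longrightarrow> y \<in> field_gen S \<Longrightarrow> x + y \<in> field_gen S"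
  using generate_field.eng_add[of x ring_of_type_algebra S y] by (simp add: ring_of_type_algebra_def)

lemma field_gen_mult: "x \<in> field_gen S \<Longrightarrow> y \<in> field_gen S \<Longrightarrow> x * y \<in> field_gen S"
  using generate_field.eng_mult[of x ring_of_type_algebra S y] by (simp add: ring_of_type_algebra_def)

lemma field_gen_inverse:
  fixes x :: "'a::field"
  assumes "x \<in> field_gen S" "x \<noteq> 0"
  shows "inverse x \<in> field_gen S"
proof -
  interpret R: Ring.field "ring_of_type_algebra :: 'a ring"
    by (rule field_from_type_algebra)
  have "inv\<^bsub>ring_of_type_algebra\<^esub> x = inverse x"
    by (rule sym, rule R.inv_unique')
      (use assms(2) in \<open>simp_all add: ring_of_type_algebra_def\<close>)
  then show ?thesis
    using generate_field.m_inv[of x ring_of_type_algebra S] assms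
    by (simp add: ring_of_type_algebra_def)
qed

lemma field_gen_poly_fract:
  "field_gen (insert (to_fract [:0, 1:]) (range (\<lambda>c::'a::field. to_fract [:c:]))) = UNIV"
    (is "field_gen ?S = UNIV")
proof -
  have poly: "to_fract p \<in> field_gen ?S" for p :: "'a poly"
  proof (induction p)
    case 0
    then show ?case
      using field_gen_incl[of "to_fract [:0:]" ?S] by simp
  next
    case (pCons c p)
    have "pCons c p = [:c:] + [:0, 1:] * p" by simp
    then have "to_fract (pCons c p) = to_fract [:c:] + to_fract [:0, 1:] * to_fract p"
      by (metis to_fract_add to_fract_mult)
    then show ?case
      using pCons.IH
      by (simp only:) (intro field_gen_add field_gen_mult, auto intro: field_gen_incl)
  qed
  have "q \<in> field_gen ?S" for q :: "'a poly fract"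
  proof (cases q)
    case (Fract a b)
    then have "q = to_fract a * inverse (to_fract b)"
      by (simp add: to_fract_def)
    then show ?thesis
      using Fract poly by (auto intro!: field_gen_mult field_gen_inverse)
  qed
  then show ?thesis by blast
qed

lemma exponential_extension_exists:
  fixes E :: "'l::field \<Rightarrow> 'l"
  assumes "derivation E"
  shows "exponential_extension E (\<lambda>c. to_fract [:c:]) (fract_deriv (exponential_poly_deriv E g))
           (to_fract [:0, 1:]) g"
proof -
  note G = derivation_exponential_poly_deriv[OF assms, of g]
  have "exponential_poly_deriv E g [:0, 1:] = [:g:] * [:0, 1:]"
    by (simp add: exponential_poly_deriv_def map_poly_pCons pderiv_pCons derivation_zero[OF assms]
        derivation_one[OF assms])
  then have "fract_deriv (exponential_poly_deriv E g) (to_fract [:0, 1:]) / to_fract [:0, 1:]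
               = to_fract [:g:]"
    by (simp only: fract_deriv_to_fract[OF G] to_fract_mult) simp
  moreover have "fract_deriv (exponential_poly_deriv E g) (to_fract [:c:]) = to_fract [:E c:]" for c
    by (simp add: fract_deriv_to_fract[OF G] exponential_poly_deriv_def map_poly_pCons
        derivation_zero[OF assms] pderiv_pCons)
  ultimately show ?thesis
    unfolding exponential_extension_def diff_field_extension_def
    using assms derivation_fract_deriv[OF G] field_gen_poly_fract
    by (auto simp flip: to_fract_add to_fract_mult to_fract_1 one_pCons)
qed

section \<open>Matrices over a differential field\<close>

definition mscale :: "'l::times \<Rightarrow> 'l^'n^'m \<Rightarrow> 'l^'n^'m" where
  "mscale c M = (\<chi> i j. c * M $ i $ j)"

lemma mscale_nth [simp]: "mscale c M $ i $ j = c * M $ i $ j"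
  by (simp add: mscale_def)

lemma matrix_deriv_nth [simp]: "matrix_deriv E M $ i $ j = E (M $ i $ j)"
  by (simp add: matrix_deriv_def)

lemma mscale_0 [simp]: "mscale c 0 = 0" "mscale 0 M = (0 :: 'l::semiring_0^'n^'m)" for c :: "'l::semiring_0"
  by (simp_all add: vec_eq_iff)

lemma mscale_1 [simp]: "mscale 1 M = M" for M :: "'l::semiring_1^'n^'m"
  by (simp add: vec_eq_iff)

lemma mscale_add: "mscale c (M + N) = mscale c M + mscale c N" for c :: "'l::ring"
  by (simp add: vec_eq_iff algebra_simps)

lemma mscale_diff: "mscale c (M - N) = mscale c M - mscale c N" for c :: "'l::ring"
  by (simp add: vec_eq_iff algebra_simps)

lemma mscale_add_left: "mscale (b + c) M = mscale b M + mscale c M" for c :: "'l::ring"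
  by (simp add: vec_eq_iff algebra_simps)

lemma mscale_mscale: "mscale b (mscale c M) = mscale (b * c) M" for c :: "'l::ring"
  by (simp add: vec_eq_iff algebra_simps)

lemma mscale_mult_left: "mscale c M ** N = mscale c (M ** N)" for c :: "'l::comm_ring_1"
  by (simp add: vec_eq_iff matrix_matrix_mult_def sum_distrib_left algebra_simps)

lemma mscale_mult_right: "M ** mscale c N = mscale c (M ** N)" for c :: "'l::comm_ring_1"
  by (simp add: vec_eq_iff matrix_matrix_mult_def sum_distrib_left algebra_simps)

lemma matrix_mul_diff_left: "(M - N) ** K = M ** K - N ** K" for M :: "'l::comm_ring_1^'n^'m"
  by (simp add: vec_eq_iff matrix_matrix_mult_def sum_subtractf algebra_simps)

lemma matrix_mul_diff_right: "K ** (M - N) = K ** M - K ** N" for M :: "'l::comm_ring_1^'n^'m"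
  by (simp add: vec_eq_iff matrix_matrix_mult_def sum_subtractf algebra_simps)

lemma matrix_mul_minus_right: "K ** (- M) = - (K ** M)" for M :: "'l::comm_ring_1^'n^'m"
  by (simp add: vec_eq_iff matrix_matrix_mult_def sum_negf)

lemma matrix_mul_add_left: "(M + N) ** K = M ** K + N ** K" for M :: "'l::comm_ring_1^'n^'m"
  by (simp add: vec_eq_iff matrix_matrix_mult_def sum.distrib algebra_simps)

lemma matrix_mul_add_right: "K ** (M + N) = K ** M + K ** N" for M :: "'l::comm_ring_1^'n^'m"
  by (simp add: vec_eq_iff matrix_matrix_mult_def sum.distrib algebra_simps)

lemma matrix_deriv_add:
  "derivation E \<Longrightarrow> matrix_deriv E (M + N) = matrix_deriv E M + matrix_deriv E N"
  by (simp add: vec_eq_iff derivation_add)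

lemma matrix_deriv_diff:
  "derivation E \<Longrightarrow> matrix_deriv E (M - N) = matrix_deriv E M - matrix_deriv E N"
  by (simp add: vec_eq_iff derivation_diff)

lemma matrix_deriv_mscale:
  "derivation E \<Longrightarrow> matrix_deriv E (mscale c M) = mscale c (matrix_deriv E M) + mscale (E c) M"
  by (simp add: vec_eq_iff derivation_mult)

lemma matrix_deriv_mult:
  "derivation E \<Longrightarrow> matrix_deriv E (M ** N) = M ** matrix_deriv E N + matrix_deriv E M ** N"
  by (simp add: vec_eq_iff matrix_matrix_mult_def derivation_sum derivation_mult sum.distrib)

lemma matrix_deriv_0: "derivation E \<Longrightarrow> matrix_deriv E 0 = 0"
  by (simp add: vec_eq_iff derivation_zero)

lemma matrix_deriv_1: "derivation E \<Longrightarrow> matrix_deriv E (mat 1) = 0"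
  by (simp add: vec_eq_iff mat_def derivation_zero derivation_one)

definition mat2 :: "'a::zero \<Rightarrow> 'a \<Rightarrow> 'a \<Rightarrow> 'a \<Rightarrow> 'a^2^2" where
  "mat2 a b c d = vector [vector [a, b], vector [c, d]]"

lemma mat2_nth [simp]:
  "mat2 a b c d $ 1 $ 1 = a" "mat2 a b c d $ 1 $ 2 = b"
  "mat2 a b c d $ 2 $ 1 = c" "mat2 a b c d $ 2 $ 2 = d"
  by (simp_all add: mat2_def)

lemma mat2_eq_iff: "M = N \<longleftrightarrow> M $ 1 $ 1 = N $ 1 $ 1 \<and> M $ 1 $ 2 = N $ 1 $ 2
    \<and> M $ 2 $ 1 = N $ 2 $ 1 \<and> M $ 2 $ 2 = N $ 2 $ 2" for M :: "'a^2^2"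
  by (simp add: vec_eq_iff forall_2)

lemma matrix_mult_2: "(M ** N) $ i $ j = M $ i $ 1 * N $ 1 $ j + M $ i $ 2 * N $ 2 $ j"
  for M :: "'a::semiring_1^2^2"
  by (simp add: matrix_matrix_mult_def sum_2)

lemma mat_1_2: "mat 1 = (mat2 1 0 0 1 :: 'a::{zero,one}^2^2)"
  by (simp add: mat2_eq_iff mat_def)

definition vec_deriv :: "('l \<Rightarrow> 'l) \<Rightarrow> 'l^'n \<Rightarrow> 'l^'n" where
  "vec_deriv E w = (\<chi> i. E (w $ i))"

lemma vec_deriv_nth [simp]: "vec_deriv E w $ i = E (w $ i)"
  by (simp add: vec_deriv_def)

lemma vec_deriv_mult:
  "derivation E \<Longrightarrow> vec_deriv E (M *v w) = M *v vec_deriv E w + matrix_deriv E M *v w"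
  by (simp add: vec_eq_iff matrix_vector_mult_def derivation_sum derivation_mult sum.distrib)

lemma vec_deriv_scale:
  "derivation E \<Longrightarrow> vec_deriv E (c *s w) = c *s vec_deriv E w + E c *s w"
  by (simp add: vec_eq_iff derivation_mult)

lemma mscale_vec: "mscale c M *v w = c *s (M *v w)" for c :: "'l::comm_ring_1"
  by (simp add: vec_eq_iff matrix_vector_mult_def sum_distrib_left mult.assoc)

section \<open>Splittings as matrix representations\<close>

text \<open>The extension of \<open>h\<close> to an additive map on formal integer combinations. The target is a ring only
  to make \<open>of_int\<close> available; for matrices, whose multiplication is here the entrywise one, this is
  still multiplication by an integer.\<close>

definition frag_sum :: "('p \<Rightarrow> 'r::ring_1) \<Rightarrow> ('p \<Rightarrow>\<^sub>0 int) \<Rightarrow> 'r" where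
  "frag_sum h f = (\<Sum>p\<in>Poly_Mapping.keys f. of_int (Poly_Mapping.lookup f p) * h p)"

lemma frag_sum_superset:
  assumes "finite T" "Poly_Mapping.keys f \<subseteq> T"
  shows "frag_sum h f = (\<Sum>p\<in>T. of_int (Poly_Mapping.lookup f p) * h p)"
  unfolding frag_sum_def using assms
  by (intro sum.mono_neutral_left) (auto simp: in_keys_iff)

lemma frag_sum_0 [simp]: "frag_sum h 0 = 0"
  by (simp add: frag_sum_def)

lemma frag_sum_of [simp]: "frag_sum h (frag_of p) = h p"
  by (simp add: frag_sum_def)

lemma frag_sum_diff: "frag_sum h (f - g) = frag_sum h f - frag_sum h g"
proof -
  let ?T = "Poly_Mapping.keys f \<union> Poly_Mapping.keys g"
  have "frag_sum h k = (\<Sum>p\<in>?T. of_int (Poly_Mapping.lookup k p) * h p)"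
    if "Poly_Mapping.keys k \<subseteq> ?T" for k
    using that by (intro frag_sum_superset) auto
  then show ?thesis
    using keys_diff[of f g] by (simp add: lookup_minus left_diff_distrib sum_subtractf)
qed

lemma frag_sum_add: "frag_sum h (f + g) = frag_sum h f + frag_sum h g"
  using frag_sum_diff[of h "f + g" g] by (simp add: algebra_simps)

lemma frag_sum_sum: "frag_sum h (\<Sum>i\<in>A. f i) = (\<Sum>i\<in>A. frag_sum h (f i))"
  by (induction A rule: infinite_finite_induct) (simp_all add: frag_sum_add)

lemma frag_induct [case_names zero of diff]:
  assumes "P 0" "\<And>p. P (frag_of p)" "\<And>f g. P f \<Longrightarrow> P g \<Longrightarrow> P (f - g)"
  shows "P f"
  using frag_induction[of f UNIV P] assms by blast

text \<open>A differential splitting without the tensor product: the restriction of an isomorphism to \<open>Q \<otimes> 1\<close>.\<close>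

definition differential_representation ::
    "('k::field \<Rightarrow> 'q::ring_1 \<Rightarrow> 'q) \<Rightarrow> ('q \<Rightarrow> 'q) \<Rightarrow> ('k \<Rightarrow> 'l::field) \<Rightarrow> ('l \<Rightarrow> 'l) \<Rightarrow>
      ('q \<Rightarrow> 'l^2^2) \<Rightarrow> bool" where
  "differential_representation smul d \<iota> E \<psi> \<longleftrightarrow>
     (\<forall>x y. \<psi> (x + y) = \<psi> x + \<psi> y) \<and>
     (\<forall>c x. \<psi> (smul c x) = mscale (\<iota> c) (\<psi> x)) \<and>
     \<psi> 1 = mat 1 \<and>
     (\<forall>x y. \<psi> (x * y) = \<psi> x ** \<psi> y) \<and>
     (\<forall>x. \<psi> (d x) = matrix_deriv E (\<psi> x))"

lemma tensor_null_frag_0_left: "frag_of (0, a) \<in> tensor_null smul \<iota>"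
  using tensor_null_uminus[OF tensor_null.add_left[of 0 0 a smul \<iota>]] by simp

lemma tensor_null_frag_0_right: "frag_of (x, 0) \<in> tensor_null smul \<iota>"
  using tensor_null_uminus[OF tensor_null.add_right[of x 0 0 smul \<iota>]] by simp

text \<open>The map \<open>\<psi> x = \<phi> (x \<otimes> 1)\<close> commutes with the derivations since \<open>1' = 0\<close> makes the second summand of
  \<open>d\<^sup>* (x \<otimes> 1) = d x \<otimes> 1 + x \<otimes> 1'\<close> vanish.\<close>

lemma split_imp_representation:
  fixes \<iota> :: "'k::field \<Rightarrow> 'l::field"
  assumes alg: "algebra_over smul" and d: "derivation_extending smul \<delta> d"
    and E: "derivation E" and \<iota>: "\<And>c. E (\<iota> c) = \<iota> (\<delta> c)"
    and split: "split_by smul d \<iota> E"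
  shows "\<exists>\<psi>. differential_representation smul d \<iota> E \<psi>"
proof -
  let ?T = "tensor_algebra smul \<iota>" and ?cl = "tensor_class smul \<iota>"
  from split obtain \<phi> where \<phi>: "\<phi> \<in> algebra_iso ?T matrix_algebra"
    and \<phi>_deriv: "\<And>t. t \<in> carrier ?T \<Longrightarrow> \<phi> (tensor_deriv smul \<iota> d E t) = matrix_deriv E (\<phi> t)"
    by (auto simp: split_by_def)
  then have hom: "\<phi> \<in> ring_hom ?T matrix_algebra"
    and scale: "\<And>c t. t \<in> carrier ?T \<Longrightarrow> \<phi> (c \<odot>\<^bsub>?T\<^esub> t) = mscale c (\<phi> t)"
    by (auto simp: algebra_iso_def ring_iso_def matrix_algebra_def mscale_def)
  have car: "?cl f \<in> carrier ?T" for f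
    by (simp add: tensor_algebra_def)
  have \<phi>_add: "\<phi> (?cl (f + g)) = \<phi> (?cl f) + \<phi> (?cl g)" for f g
    using ring_hom_add[OF hom car car, of f g] by (simp add: tensor_add_class matrix_algebra_def)
  have \<phi>_mult: "\<phi> (?cl (formal_mult f g)) = \<phi> (?cl f) ** \<phi> (?cl g)" for f g
    using ring_hom_mult[OF hom car car, of f g]
    by (simp add: tensor_mult_class[OF alg] matrix_algebra_def)
  define \<psi> where "\<psi> x = \<phi> (?cl (frag_of (x, 1)))" for x
  have "\<psi> (x + y) = \<psi> x + \<psi> y" for x y
  proof -
    have "?cl (frag_of (x + y, 1)) = ?cl (frag_of (x, 1) + frag_of (y, 1))"
      unfolding tensor_class_eq_iff
      using tensor_null.add_left[of x y 1 smul \<iota>] by (simp add: algebra_simps)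
    then show ?thesis by (simp add: \<psi>_def \<phi>_add)
  qed
  moreover have "\<psi> (smul c x) = mscale (\<iota> c) (\<psi> x)" for c x
  proof -
    have "?cl (frag_of (smul c x, 1)) = ?cl (formal_smult (\<iota> c) (frag_of (x, 1)))"
      unfolding tensor_class_eq_iff formal_smult_def
      using tensor_null.balanced[of smul c x 1 \<iota>] by simp
    then show ?thesis
      by (simp add: \<psi>_def scale[OF car] flip: tensor_smult_class)
  qed
  moreover have "\<psi> 1 = mat 1"
    using ring_hom_one[OF hom] by (simp add: \<psi>_def tensor_algebra_def matrix_algebra_def)
  moreover have "\<psi> (x * y) = \<psi> x ** \<psi> y" for x y
    using \<phi>_mult[of "frag_of (x, 1)" "frag_of (y, 1)"] by (simp add: \<psi>_def formal_mult_def)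
  moreover have "\<psi> (d x) = matrix_deriv E (\<psi> x)" for x
  proof -
    have "?cl (formal_deriv d E (frag_of (x, 1))) = ?cl (frag_of (d x, 1))"
      unfolding tensor_class_eq_iff formal_deriv_def
      by (simp add: derivation_one[OF E] tensor_null_frag_0_right)
    then show ?thesis
      using \<phi>_deriv[OF car, of "frag_of (x, 1)"]
      by (simp add: \<psi>_def tensor_deriv_class[where \<iota> = \<iota> and E = E, OF alg d E \<iota>])
  qed
  ultimately show ?thesis
    unfolding differential_representation_def by blast
qed

lemma tensor_null_frag_sum_left:
  "frag_of (\<Sum>b\<in>B. y b, c) - (\<Sum>b\<in>B. frag_of (y b, c)) \<in> tensor_null smul \<iota>"
proof (induction B rule: infinite_finite_induct)
  case (insert b B)
  have "(frag_of (y b + (\<Sum>b\<in>B. y b), c) - frag_of (y b, c) - frag_of (\<Sum>b\<in>B. y b, c))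
          + (frag_of (\<Sum>b\<in>B. y b, c) - (\<Sum>b\<in>B. frag_of (y b, c))) \<in> tensor_null smul \<iota>"
    by (intro tensor_null_add tensor_null.add_left insert.IH)
  then show ?case
    using insert.hyps by (simp add: algebra_simps)
qed (simp_all add: tensor_null_frag_0_left)

lemma tensor_null_sum:
  "(\<And>b. b \<in> B \<Longrightarrow> f b \<in> tensor_null smul \<iota>) \<Longrightarrow> (\<Sum>b\<in>B. f b) \<in> tensor_null smul \<iota>"
  by (induction B rule: infinite_finite_induct) (auto intro: tensor_null.zero tensor_null_add)

text \<open>Every tensor is a combination of the \<open>b \<otimes> 1\<close> for \<open>b\<close> in a finite spanning set: expand the left
  factor and move the coefficients across the tensor sign.\<close>

lemma tensor_normal_form:
  fixes \<iota> :: "'k::field \<Rightarrow> 'l::field"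
  assumes alg: "algebra_over smul" and B: "finite B"
    "module.span smul B = UNIV"
  shows "\<exists>a. f - (\<Sum>b\<in>B. frag_of (b, a b)) \<in> tensor_null smul \<iota>"
proof (induction f rule: frag_induct)
  case zero
  have "(\<Sum>b\<in>B. frag_of (b, 0)) \<in> tensor_null smul \<iota>"
    by (intro tensor_null_sum tensor_null_frag_0_right)
  from tensor_null_uminus[OF this] show ?case
    by (intro exI[of _ "\<lambda>_. 0"]) simp
next
  case (of p)
  interpret algebra_over smul by fact
  obtain x c where p: "p = (x, c)" by (cases p)
  obtain r where x: "x = (\<Sum>b\<in>B. smul (r b) b)"
    using span_finite[OF B(1)] B(2) by (metis (no_types, lifting) UNIV_I imageE)
  have "(frag_of (x, c) - (\<Sum>b\<in>B. frag_of (smul (r b) b, c)))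
        + (\<Sum>b\<in>B. frag_of (smul (r b) b, c) - frag_of (b, \<iota> (r b) * c)) \<in> tensor_null smul \<iota>"
    unfolding x
    by (intro tensor_null_add tensor_null_frag_sum_left tensor_null_sum tensor_null.balanced)
  then show ?case
    by (intro exI[of _ "\<lambda>b. \<iota> (r b) * c"]) (simp add: p sum_subtractf)
next
  case (diff f g)
  then obtain a a' where "f - (\<Sum>b\<in>B. frag_of (b, a b)) \<in> tensor_null smul \<iota>"
    "g - (\<Sum>b\<in>B. frag_of (b, a' b)) \<in> tensor_null smul \<iota>" by blast
  moreover have "(\<Sum>b\<in>B. frag_of (b, (a b - a' b) + a' b) - frag_of (b, a b - a' b) - frag_of (b, a' b))
      \<in> tensor_null smul \<iota>"
    by (intro tensor_null_sum tensor_null.add_right)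
  ultimately have "((f - (\<Sum>b\<in>B. frag_of (b, a b))) - (g - (\<Sum>b\<in>B. frag_of (b, a' b))))
      + (\<Sum>b\<in>B. frag_of (b, (a b - a' b) + a' b) - frag_of (b, a b - a' b) - frag_of (b, a' b))
      \<in> tensor_null smul \<iota>"
    by (blast intro: tensor_null_add[OF tensor_null.diff])
  then show ?case
    by (intro exI[of _ "\<lambda>b. a b - a' b"]) (simp add: sum_subtractf sum.distrib algebra_simps)
qed

text \<open>The isomorphism sends \<open>x \<otimes> a\<close> to \<open>a \<psi> x\<close>. It is bijective because the images of the elements of \<open>B\<close>
  form a basis of the matrix algebra: by the normal form, a tensor that is sent to zero has zero
  coefficients, hence is null.\<close>

lemma representation_imp_split:
  fixes \<iota> :: "'k::field \<Rightarrow> 'l::field"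
  assumes alg: "algebra_over smul" and d: "derivation_extending smul \<delta> d"
    and E: "derivation E" and \<iota>: "\<And>c. E (\<iota> c) = \<iota> (\<delta> c)"
    and rep: "differential_representation smul d \<iota> E \<psi>"
    and B: "finite B" "module.span smul B = UNIV"
    and span: "\<And>N. \<exists>a. N = (\<Sum>b\<in>B. mscale (a b) (\<psi> b))"
    and indep: "\<And>a b. (\<Sum>b\<in>B. mscale (a b) (\<psi> b)) = 0 \<Longrightarrow> b \<in> B \<Longrightarrow> a b = 0"
  shows "split_by smul d \<iota> E"
proof -
  let ?T = "tensor_algebra smul \<iota>" and ?cl = "tensor_class smul \<iota>"
  have \<psi>: "\<psi> (x + y) = \<psi> x + \<psi> y" "\<psi> (smul c x) = mscale (\<iota> c) (\<psi> x)" "\<psi> 1 = mat 1"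
    "\<psi> (x * y) = \<psi> x ** \<psi> y" "\<psi> (d x) = matrix_deriv E (\<psi> x)" for c x y
    using rep by (simp_all add: differential_representation_def)
  define lift where "lift = frag_sum (\<lambda>(x, a). mscale a (\<psi> x))"
  have lift_of: "lift (frag_of (x, a)) = mscale a (\<psi> x)" for x a
    by (simp add: lift_def)
  have lift_diff: "lift (f - g) = lift f - lift g" and lift_add: "lift (f + g) = lift f + lift g"
    and lift_sum: "lift (sum F A) = (\<Sum>b\<in>A. lift (F b))" and lift_0: "lift 0 = 0"
    for f g and F :: "_ \<Rightarrow> _" and A :: "'q set"
    by (simp_all add: lift_def frag_sum_diff frag_sum_add frag_sum_sum)
  have lift_null: "lift f = 0" if "f \<in> tensor_null smul \<iota>" for f
    using that
    by induction (simp_all add: lift_diff lift_0 lift_of \<psi> mscale_add mscale_add_left mscale_mscale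
        mult.commute)
  have null_lift: "f \<in> tensor_null smul \<iota>" if "lift f = 0" for f
  proof -
    obtain a where a: "f - (\<Sum>b\<in>B. frag_of (b, a b)) \<in> tensor_null smul \<iota>"
      using tensor_normal_form[OF alg B] by blast
    have "(\<Sum>b\<in>B. mscale (a b) (\<psi> b)) = 0"
      using lift_null[OF a] that by (simp add: lift_diff lift_sum lift_of)
    then have "(\<Sum>b\<in>B. frag_of (b, a b)) = (\<Sum>b\<in>B. frag_of (b, 0))"
      by (intro sum.cong refl) (simp add: indep[of a])
    then have "(\<Sum>b\<in>B. frag_of (b, a b)) \<in> tensor_null smul \<iota>"
      by (simp add: tensor_null_sum tensor_null_frag_0_right)
    from tensor_null_add[OF a this] show ?thesis by simp
  qed
  define \<phi> where "\<phi> t = lift (SOME f. f \<in> t)" for t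
  have \<phi>: "\<phi> (?cl f) = lift f" for f
  proof -
    have "(SOME g. g \<in> ?cl f) \<in> ?cl f"
      using tensor_class_self by (rule someI)
    then show ?thesis
      using lift_null[of "(SOME g. g \<in> ?cl f) - f"]
      by (simp add: \<phi>_def tensor_class_def lift_diff)
  qed
  \<comment> \<open>Both sides are additive in each argument, so pure tensors suffice.\<close>
  have lift_mult: "lift (formal_mult f g) = lift f ** lift g" for f g
  proof (induction f rule: frag_induct)
    case zero
    then show ?case by (simp add: formal_mult_def lift_0)
  next
    case (of p)
    show ?case
      by (induction g rule: frag_induct; cases p)
        (auto simp: formal_mult_def lift_0 lift_of lift_diff frag_extend_diff \<psi>
          mscale_mult_left mscale_mult_right mscale_mscale matrix_mul_diff_right mult.commute)
  next
    case (diff f f')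
    then show ?case
      by (simp add: formal_mult_def frag_extend_diff lift_diff matrix_mul_diff_left)
  qed
  have lift_smult: "lift (formal_smult c f) = mscale c (lift f)" for c f
    by (induction f rule: frag_induct)
      (auto simp: formal_smult_def lift_0 lift_of lift_diff frag_extend_diff mscale_mscale mscale_diff)
  have lift_deriv: "lift (formal_deriv d E f) = matrix_deriv E (lift f)" for f
    by (induction f rule: frag_induct)
      (auto simp: formal_deriv_def lift_0 lift_of lift_add lift_diff frag_extend_diff \<psi>
        matrix_deriv_0[OF E] matrix_deriv_mscale[OF E] matrix_deriv_diff[OF E])
  have car: "carrier ?T = range ?cl"
    by (simp add: tensor_algebra_def)
  have "\<phi> \<in> ring_hom ?T matrix_algebra"
    by (rule ring_hom_memI)
      (auto simp: car tensor_mult_class[OF alg] tensor_add_class \<phi> lift_mult lift_add matrix_algebra_def,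
       simp add: tensor_algebra_def \<phi> lift_of \<psi>)
  moreover have "inj_on \<phi> (carrier ?T)"
    by (auto simp: inj_on_def car \<phi> tensor_class_eq_iff lift_diff intro!: null_lift)
  moreover have "\<phi> ` carrier ?T = UNIV"
  proof (rule UNIV_eq_I[symmetric])
    fix N
    obtain a where "N = (\<Sum>b\<in>B. mscale (a b) (\<psi> b))" using span by blast
    then have "N = \<phi> (?cl (\<Sum>b\<in>B. frag_of (b, a b)))"
      by (simp add: \<phi> lift_sum lift_of)
    then show "N \<in> \<phi> ` carrier ?T" by (auto simp: car)
  qed
  moreover have "\<phi> (c \<odot>\<^bsub>?T\<^esub> t) = mscale c (\<phi> t)" if "t \<in> carrier ?T" for c t
    using that by (auto simp: car tensor_smult_class \<phi> lift_smult)
  ultimately have "\<phi> \<in> algebra_iso ?T matrix_algebra"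
    by (auto simp: algebra_iso_def ring_iso_def bij_betw_def matrix_algebra_def mscale_def)
  moreover have "\<phi> (tensor_deriv smul \<iota> d E t) = matrix_deriv E (\<phi> t)" if "t \<in> carrier ?T" for t
    using that by (auto simp: car tensor_deriv_class[where \<iota> = \<iota> and E = E, OF alg d E \<iota>] \<phi> lift_deriv)
  ultimately show ?thesis
    unfolding split_by_def by blast
qed

section \<open>Quaternion algebras and their derivations\<close>

context quaternion_algebra
begin

abbreviation basis :: "'q set" where
  "basis \<equiv> {1, u, v, u * v}"

lemma basis_neq [simp]:
  "u \<noteq> 1" "v \<noteq> 1" "u * v \<noteq> 1" "1 \<noteq> u" "1 \<noteq> v" "1 \<noteq> u * v"
  "u \<noteq> v" "v \<noteq> u" "u \<noteq> u * v" "u * v \<noteq> u" "v \<noteq> u * v" "u * v \<noteq> v"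
  using basis_distinct by auto

lemma algebra: "algebra_over smul"
  by unfold_locales

lemma quaternion_coordinates:
  "\<exists>a b c e. x = smul a 1 + smul b u + smul c v + smul e (u * v)"
proof -
  have "x \<in> span basis" by (simp add: basis_span)
  then obtain r where "x = (\<Sum>w\<in>basis. smul (r w) w)"
    using span_finite[of basis] by auto
  then have "x = smul (r 1) 1 + smul (r u) u + smul (r v) v + smul (r (u * v)) (u * v)"
    using basis_distinct by (simp add: algebra_simps)
  then show ?thesis by blast
qed

lemma quaternion_induct [case_names 1 u v add smul mult]:
  assumes "P 1" "P u" "P v" "\<And>x y. P x \<Longrightarrow> P y \<Longrightarrow> P (x + y)" "\<And>c x. P x \<Longrightarrow> P (smul c x)"
    "\<And>x y. P x \<Longrightarrow> P y \<Longrightarrow> P (x * y)"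
  shows "P x"
  using quaternion_coordinates[of x] assms by metis

lemma vu: "v * u = smul (-1) (u * v)"
  by (simp add: anticommute)

lemma uuv: "u * (u * v) = smul \<alpha> v"
  by (metis mult.assoc mult_1 smul_mult_left u_square)

lemma vuv: "v * (u * v) = smul (- \<beta>) u"
  by (metis anticommute minus_mult_left mult.assoc mult.right_neutral scale_minus_left smul_mult_right v_square)

lemma independent_pair:
  assumes w: "w \<in> {u, v}" and eq: "smul a 1 + smul b w = 0"
  shows "a = 0 \<and> b = 0"
proof -
  have "1 \<noteq> w" using w basis_distinct by auto
  then have "(\<Sum>x\<in>{1, w}. smul (if x = 1 then a else b) x) = 0"
    using eq by simp
  moreover have "independent {1, w}"
    using w by (intro independent_mono[OF basis_independent]) auto
  ultimately have "(if x = 1 then a else b) = 0" if "x \<in> {1, w}" for x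
    using that independentD[of "{1, w}" "{1, w}" "\<lambda>x. if x = 1 then a else b" x] by blast
  from this[of 1] this[of w] \<open>1 \<noteq> w\<close> show ?thesis by simp
qed

text \<open>Differentiating \<open>w\<^sup>2 = \<gamma>\<close> gives \<open>2 b \<gamma> + 2 a w = \<gamma>'\<close>, and \<open>1\<close>, \<open>w\<close> are independent.\<close>

lemma derivation_of_generator:
  assumes two: "(2::'k) \<noteq> 0" and e: "derivation_extending smul \<delta> e"
    and w: "w \<in> {u, v}" and ww: "w * w = smul \<gamma> 1" and "\<gamma> \<noteq> 0"
    and ew: "e w = smul a 1 + smul b w"
  shows "e w = smul (\<delta> \<gamma> / (2 * \<gamma>)) w"
proof -
  have "e (w * w) = w * e w + e w * w" and "e (smul \<gamma> 1) = smul (\<delta> \<gamma>) 1"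
    using e by (simp_all add: derivation_extending_def derivation_on_def)
  then have "w * (smul a 1 + smul b w) + (smul a 1 + smul b w) * w = smul (\<delta> \<gamma>) 1"
    by (simp only: ew ww)
  then have "(smul a w + smul a w) + (smul (b * \<gamma>) 1 + smul (b * \<gamma>) 1) = smul (\<delta> \<gamma>) 1"
    by (simp add: ww smul_mult_left smul_mult_right distrib_left distrib_right ac_simps)
  moreover have "smul (2 * b * \<gamma> - \<delta> \<gamma>) 1 + smul (2 * a) w
      = ((smul a w + smul a w) + (smul (b * \<gamma>) 1 + smul (b * \<gamma>) 1)) - smul (\<delta> \<gamma>) 1"
    by (simp only: mult_2 distrib_right scale_left_diff_distrib scale_left_distrib)
      (simp only: algebra_simps)
  ultimately have "smul (2 * b * \<gamma> - \<delta> \<gamma>) 1 + smul (2 * a) w = 0"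
    by simp
  then have "2 * b * \<gamma> - \<delta> \<gamma> = 0 \<and> 2 * a = 0"
    using independent_pair[OF w] by blast
  then have "b = \<delta> \<gamma> / (2 * \<gamma>)" "a = 0"
    using two \<open>\<gamma> \<noteq> 0\<close> by (auto simp: field_simps)
  then show ?thesis by (simp add: ew)
qed

lemma derivation_on_generators:
  assumes two: "(2::'k) \<noteq> 0" and std: "standard_derivation smul \<delta> u v d_uv"
    and \<theta>: "\<theta> = smul a1 u + smul a2 v + smul a3 (u * v)"
    and d: "\<And>x. d x = d_uv x + inner_derivation \<theta> x"
  shows "d u = smul (\<delta> \<alpha> / (2 * \<alpha>)) u + smul (2 * a3 * \<alpha>) v + smul (2 * a2) (u * v)"
    and "d v = smul (- 2 * a3 * \<beta>) u + smul (\<delta> \<beta> / (2 * \<beta>)) v + smul (- 2 * a1) (u * v)"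
proof -
  have e: "derivation_extending smul \<delta> d_uv"
    using std by (simp add: standard_derivation_def)
  have "d_uv u = smul (\<delta> \<alpha> / (2 * \<alpha>)) u"
    using std derivation_of_generator[OF two e _ u_square \<alpha>_nonzero]
    by (auto simp: standard_derivation_def)
  moreover have "d_uv v = smul (\<delta> \<beta> / (2 * \<beta>)) v"
    using std derivation_of_generator[OF two e _ v_square \<beta>_nonzero]
    by (auto simp: standard_derivation_def)
  moreover have "smul (2 * c) x = smul c x + smul c x" for c x
    by (simp only: mult_2 scale_left_distrib)
  moreover have "smul (- 2 * c) x = - (smul c x + smul c x)" for c x
    by (simp only: mult_minus_left mult_2 scale_left_distrib scale_minus_left)
  moreover have "smul (2 * a3 * \<alpha>) v = smul (a3 * \<alpha>) v + smul (a3 * \<alpha>) v"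
    "smul (- 2 * a3 * \<beta>) u = - (smul (a3 * \<beta>) u + smul (a3 * \<beta>) u)"
    by (simp_all only: mult_minus_left mult.assoc mult_2 distrib_right scale_left_distrib scale_minus_left)
  ultimately show "d u = smul (\<delta> \<alpha> / (2 * \<alpha>)) u + smul (2 * a3 * \<alpha>) v + smul (2 * a2) (u * v)"
    and "d v = smul (- 2 * a3 * \<beta>) u + smul (\<delta> \<beta> / (2 * \<beta>)) v + smul (- 2 * a1) (u * v)"
    by (simp_all add: d inner_derivation_def \<theta> distrib_left distrib_right smul_mult_left smul_mult_right
        u_square v_square anticommute uuv vuv scale_right_distrib algebra_simps)
qed

end

section \<open>The standard representation over a field containing a square root of \<open>\<alpha>\<close>\<close>

text \<open>The coefficients \<open>a1\<close>, \<open>a2\<close>, \<open>a3\<close> of \<open>\<theta>\<close> enter only through the values of \<open>d\<close> on the generators.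
  The locale has the field \<open>'l\<close> as a parameter so that it can be applied to \<open>L\<close> and to
  \<open>L(\<mu>)\<close> alike.\<close>

locale quaternion_over_splitting_field = quaternion_algebra smul \<alpha> \<beta> u v
  for smul :: "'k::field \<Rightarrow> 'q::ring_1 \<Rightarrow> 'q" and \<alpha> \<beta> u v +
  fixes \<delta> :: "'k \<Rightarrow> 'k" and d :: "'q \<Rightarrow> 'q" and a1 a2 a3 :: 'k
    and \<iota> :: "'k \<Rightarrow> 'l::field" and E :: "'l \<Rightarrow> 'l" and \<xi> :: 'l
  assumes d: "derivation_extending smul \<delta> d"
    and d_u: "d u = smul (\<delta> \<alpha> / (2 * \<alpha>)) u + smul (2 * a3 * \<alpha>) v + smul (2 * a2) (u * v)"
    and d_v: "d v = smul (- 2 * a3 * \<beta>) u + smul (\<delta> \<beta> / (2 * \<beta>)) v + smul (- 2 * a1) (u * v)"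
    and E: "derivation E"
    and \<iota>_1: "\<iota> 1 = 1" and \<iota>_add: "\<And>x y. \<iota> (x + y) = \<iota> x + \<iota> y"
    and \<iota>_mult: "\<And>x y. \<iota> (x * y) = \<iota> x * \<iota> y"
    and E_\<iota>: "\<And>c. E (\<iota> c) = \<iota> (\<delta> c)"
    and \<xi>_square: "\<xi>\<^sup>2 = \<iota> \<alpha>"
    and two: "(2::'l) \<noteq> 0"
begin

lemma \<iota>_0 [simp]: "\<iota> 0 = 0"
  by (metis \<iota>_add add_cancel_right_right)

lemma \<iota>_minus: "\<iota> (- x) = - \<iota> x"
  using \<iota>_add[of x "- x"] by (simp add: eq_neg_iff_add_eq_0 add.commute)

lemma \<iota>_2: "\<iota> 2 = 2"
  using \<iota>_add[of 1 1] by (simp add: \<iota>_1)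

lemma \<iota>_eq_0: "\<iota> x = 0 \<longleftrightarrow> x = 0"
proof
  assume "\<iota> x = 0"
  then have "\<iota> (x * inverse x) = 0" by (simp add: \<iota>_mult)
  then show "x = 0" by (cases "x = 0") (simp_all add: \<iota>_1)
qed simp

lemma \<iota>_divide: "y \<noteq> 0 \<Longrightarrow> \<iota> (x / y) = \<iota> x / \<iota> y"
  by (simp add: \<iota>_eq_0 eq_divide_eq flip: \<iota>_mult)

lemmas \<iota>_simps = \<iota>_1 \<iota>_add \<iota>_mult \<iota>_minus \<iota>_2 \<iota>_divide

lemma two_k: "(2::'k) \<noteq> 0"
  by (metis two \<iota>_2 \<iota>_0)

lemma \<xi>_nonzero: "\<xi> \<noteq> 0"
  using \<xi>_square \<alpha>_nonzero by (auto simp: \<iota>_eq_0)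

lemma \<xi>_\<xi>: "\<xi> * \<xi> = \<iota> \<alpha>" "\<xi> * (\<xi> * z) = \<iota> \<alpha> * z"
  using \<xi>_square by (simp_all add: power2_eq_square flip: mult.assoc)

lemma E_\<xi>: "E \<xi> = \<iota> (\<delta> \<alpha> / (2 * \<alpha>)) * \<xi>"
proof -
  have "E (\<xi> * \<xi>) = \<iota> (\<delta> \<alpha>)"
    using \<xi>_square by (simp add: power2_eq_square E_\<iota>)
  then have "E \<xi> * (2 * \<xi>) = \<iota> (\<delta> \<alpha>)"
    by (simp add: derivation_mult[OF E] algebra_simps)
  then have "E \<xi> = \<iota> (\<delta> \<alpha>) / (2 * \<xi>)"
    using two \<xi>_nonzero by (simp add: eq_divide_eq)
  also have "\<dots> = \<iota> (\<delta> \<alpha>) / (2 * \<xi>\<^sup>2) * \<xi>"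
    using \<xi>_nonzero by (simp add: power2_eq_square)
  also have "\<iota> (\<delta> \<alpha>) / (2 * \<xi>\<^sup>2) = \<iota> (\<delta> \<alpha> / (2 * \<alpha>))"
    using two_k \<alpha>_nonzero by (simp add: \<iota>_simps \<xi>_square)
  finally show ?thesis .
qed

text \<open>With these names the Riccati equation reads \<open>X' = c_plus \<beta> + 2 m X - c_minus X\<^sup>2\<close>.\<close>

definition "c_plus = \<iota> a2 + \<iota> a3 * \<xi>"
definition "c_minus = \<iota> a2 - \<iota> a3 * \<xi>"
definition "m = \<iota> a1 * \<xi> + \<iota> (\<delta> \<beta>) / (4 * \<iota> \<beta>)"

text \<open>The representation in which \<open>u\<close> is the diagonal matrix with entries \<open>\<xi>\<close>, \<open>- \<xi>\<close> and \<open>v\<close> interchanges the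
  two eigenspaces, written out in coordinates.\<close>

definition standard_rep :: "'q \<Rightarrow> 'l^2^2" where
  "standard_rep x = (let r = (\<lambda>w. \<iota> (representation basis x w)) in
     mat2 (r 1 + r u * \<xi>) (\<iota> \<beta> * (r v + r (u * v) * \<xi>))
          (r v - r (u * v) * \<xi>) (r 1 - r u * \<xi>))"

lemma standard_rep_add: "standard_rep (x + y) = standard_rep x + standard_rep y"
  by (simp add: standard_rep_def Let_def mat2_eq_iff representation_add basis_independent
      basis_span \<iota>_add algebra_simps)

lemma standard_rep_smul: "standard_rep (smul c x) = mscale (\<iota> c) (standard_rep x)"
  by (simp add: standard_rep_def Let_def mat2_eq_iff representation_scale basis_independent
      basis_span \<iota>_mult algebra_simps)

lemma standard_rep_basis:
  "standard_rep 1 = mat 1" "standard_rep u = mat2 \<xi> 0 0 (- \<xi>)" "standard_rep v = mat2 0 (\<iota> \<beta>) 1 0"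
  "standard_rep (u * v) = mat2 0 (\<iota> \<beta> * \<xi>) (- \<xi>) 0"
  using basis_distinct
  by (auto simp: standard_rep_def Let_def mat2_eq_iff mat_1_2 representation_basis[OF basis_independent]
      \<iota>_1)

lemma standard_rep_mult: "standard_rep (x * y) = standard_rep x ** standard_rep y"
proof (induction x arbitrary: y rule: quaternion_induct)
  case (add x x')
  then show ?case by (simp add: distrib_right standard_rep_add matrix_mul_add_left)
next
  case (smul c x)
  then show ?case by (simp add: smul_mult_left standard_rep_smul mscale_mult_left)
next
  case (mult x x')
  then show ?case by (simp add: mult.assoc matrix_mul_assoc)
next
  case u
  obtain a b c e where "y = smul a 1 + smul b u + smul c v + smul e (u * v)"
    using quaternion_coordinates by blast
  then show ?case
    by (simp add: distrib_left smul_mult_right u_square uuv standard_rep_add standard_rep_smul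
        standard_rep_basis mat2_eq_iff matrix_mult_2 mat_1_2 \<xi>_\<xi> \<iota>_mult algebra_simps)
next
  case v
  obtain a b c e where "y = smul a 1 + smul b u + smul c v + smul e (u * v)"
    using quaternion_coordinates by blast
  then show ?case
    by (simp add: distrib_left smul_mult_right v_square vu vuv standard_rep_add standard_rep_smul
        standard_rep_basis mat2_eq_iff matrix_mult_2 mat_1_2 \<iota>_minus \<iota>_1 \<iota>_mult algebra_simps
        del: scale_minus_left)
qed (simp add: standard_rep_basis)

text \<open>The matrix \<open>P\<close> of the linear system \<open>A' = A P\<close>. Its commutator with the images of the generators is
  prescribed by \<open>d u\<close> and \<open>d v\<close>, which determines it up to the scalar matrix \<open>p\<close>.\<close>

definition connection :: "'l \<Rightarrow> 'l^2^2" where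
  "connection p = mat2 p (- c_plus * \<iota> \<beta>) (- c_minus) (p + 2 * m)"

lemma two_m: "2 * m = 2 * \<iota> a1 * \<xi> + \<iota> (\<delta> \<beta>) / (2 * \<iota> \<beta>)"
proof -
  have "2 * (\<iota> (\<delta> \<beta>) / (4 * \<iota> \<beta>)) = \<iota> (\<delta> \<beta>) / (2 * \<iota> \<beta>)"
    using mult_divide_mult_cancel_left[OF two, of "\<iota> (\<delta> \<beta>)" "2 * \<iota> \<beta>"] by simp
  then show ?thesis
    by (simp add: m_def distrib_left)
qed

text \<open>The derivation \<open>d\<close> corresponds to \<open>X \<mapsto> X' + P X - X P\<close>. Both sides are derivations along the
  standard representation, so it is enough to compare them on \<open>u\<close> and \<open>v\<close>.\<close>

lemma standard_rep_deriv:
  "standard_rep (d x) + standard_rep x ** connection p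
     = matrix_deriv E (standard_rep x) + connection p ** standard_rep x"
proof (induction x rule: quaternion_induct)
  case 1
  have "d 1 = 0" using d by (simp add: derivation_extending_def derivation_one)
  moreover have "standard_rep 0 = 0"
    using standard_rep_add[of 0 0] by simp
  ultimately show ?case
    by (simp add: standard_rep_basis matrix_deriv_1[OF E])
next
  case u
  show ?case
    unfolding d_u standard_rep_add standard_rep_smul standard_rep_basis
    by (simp add: mat2_eq_iff matrix_mult_2 connection_def E_\<xi> derivation_zero[OF E] derivation_minus[OF E]
        c_plus_def c_minus_def \<iota>_mult \<iota>_2 \<xi>_\<xi> algebra_simps)
next
  case v
  have "\<iota> (\<delta> \<beta> / (2 * \<beta>)) = \<iota> (\<delta> \<beta>) / (2 * \<iota> \<beta>)"
    using \<beta>_nonzero two_k by (simp add: \<iota>_simps)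
  then show ?case
    unfolding d_v standard_rep_add standard_rep_smul standard_rep_basis
    using two \<beta>_nonzero
    by (simp add: mat2_eq_iff matrix_mult_2 connection_def derivation_zero[OF E] derivation_one[OF E] two_m E_\<iota>
        c_plus_def c_minus_def \<iota>_mult \<iota>_2 \<iota>_minus \<iota>_eq_0 \<xi>_\<xi> algebra_simps)
next
  case (add x y)
  have "d (x + y) = d x + d y"
    using d by (simp add: derivation_extending_def derivation_add)
  then show ?case
    using add by (simp add: standard_rep_add matrix_mul_add_left matrix_mul_add_right
        matrix_deriv_add[OF E] algebra_simps)
next
  case (smul c x)
  have "d (smul c 1 * x) = smul c 1 * d x + d (smul c 1) * x"
    using d by (simp add: derivation_extending_def derivation_mult)
  then have "d (smul c x) = smul c (d x) + smul (\<delta> c) x"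
    using d by (simp add: derivation_extending_def smul_mult_left)
  then have "standard_rep (d (smul c x)) + standard_rep (smul c x) ** connection p
      = mscale (\<iota> c) (standard_rep (d x) + standard_rep x ** connection p)
        + mscale (\<iota> (\<delta> c)) (standard_rep x)"
    by (simp add: standard_rep_add standard_rep_smul mscale_mult_left mscale_add algebra_simps)
  then show ?case
    by (simp add: smul standard_rep_smul matrix_deriv_mscale[OF E] E_\<iota> mscale_add mscale_mult_right
        algebra_simps)
next
  case (mult x y)
  let ?R = standard_rep and ?P = "connection p"
  have "d (x * y) = x * d y + d x * y"
    using d by (simp add: derivation_extending_def derivation_mult)
  then have "?R (d (x * y)) + ?R (x * y) ** ?P
      = ?R x ** (?R (d y) + ?R y ** ?P) + ?R (d x) ** ?R y"
    by (simp add: standard_rep_add standard_rep_mult matrix_mul_add_right matrix_mul_assoc algebra_simps)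
  also have "\<dots> = ?R x ** matrix_deriv E (?R y) + (?R (d x) + ?R x ** ?P) ** ?R y"
    unfolding mult(2)
    by (simp add: matrix_mul_add_left matrix_mul_add_right matrix_mul_assoc algebra_simps)
  also have "\<dots> = matrix_deriv E (?R (x * y)) + ?P ** ?R (x * y)"
    unfolding mult(1)
    by (simp add: matrix_mul_add_left standard_rep_mult matrix_deriv_mult[OF E] matrix_mul_assoc
        algebra_simps)
  finally show ?case .
qed

end

section \<open>Differential frames\<close>

context quaternion_over_splitting_field
begin

text \<open>The columns \<open>e\<close>, \<open>f\<close> of an invertible solution of \<open>A' = A P\<close>, where \<open>P = connection p\<close>.\<close>

definition differential_frame :: "'l^2 \<Rightarrow> 'l^2 \<Rightarrow> 'l \<Rightarrow> bool" where
  "differential_frame e f p \<longleftrightarrow> e $ 1 * f $ 2 - e $ 2 * f $ 1 \<noteq> 0 \<and>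
     vec_deriv E e = p *s e - c_minus *s f \<and>
     vec_deriv E f = (p + 2 * m) *s f - (c_plus * \<iota> \<beta>) *s e"

definition riccati :: "'l \<Rightarrow> bool" where
  "riccati x \<longleftrightarrow> E x = c_plus * \<iota> \<beta> + 2 * m * x - c_minus * x\<^sup>2"

lemma sum_basis: "(\<Sum>w\<in>basis. F w) = F 1 + F u + F v + F (u * v)"
  using basis_distinct by (simp add: add.assoc)

text \<open>The diagonal entries determine the coefficients of \<open>1\<close> and \<open>u\<close>, and the other two those of \<open>v\<close> and
  \<open>u v\<close>; this is where \<open>2\<close>, \<open>\<xi>\<close> and \<open>\<beta>\<close> have to be invertible.\<close>

lemma standard_rep_span: "\<exists>a. N = (\<Sum>w\<in>basis. mscale (a w) (standard_rep w))"
proof -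
  let ?a = "\<lambda>x y z w b. if b = 1 then x else if b = u then y else if b = v then z else w"
  have "\<exists>x y. x + y * \<xi> = a \<and> x - y * \<xi> = b" for a b
  proof (intro exI)
    have "(a + b) / 2 + (a - b) / 2 = a" "(a + b) / 2 - (a - b) / 2 = b"
      using nonzero_mult_div_cancel_left[OF two]
      by (simp_all flip: add_divide_distrib diff_divide_distrib)
    moreover have "t / \<xi> * \<xi> = t" for t
      using \<xi>_nonzero by simp
    ultimately show "(a + b) / 2 + (a - b) / 2 / \<xi> * \<xi> = a \<and> (a + b) / 2 - (a - b) / 2 / \<xi> * \<xi> = b"
      by (simp only: simp_thms)
  qed
  then obtain x y z w where xy: "x + y * \<xi> = N $ 1 $ 1" "x - y * \<xi> = N $ 2 $ 2"
    and zw: "z + w * \<xi> = N $ 1 $ 2 / \<iota> \<beta>" "z - w * \<xi> = N $ 2 $ 1"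
    by metis
  have "\<iota> \<beta> * (z + w * \<xi>) = N $ 1 $ 2"
    using \<beta>_nonzero by (simp add: zw \<iota>_eq_0)
  then have "N = (\<Sum>b\<in>basis. mscale (?a x y z w b) (standard_rep b))"
    by (simp add: sum_basis standard_rep_basis mat2_eq_iff mat_1_2 algebra_simps flip: xy zw(2))
  then show ?thesis by (rule exI[of _ "?a x y z w"])
qed

lemma standard_rep_independent:
  assumes "(\<Sum>w\<in>basis. mscale (a w) (standard_rep w)) = 0" "w \<in> basis"
  shows "a w = 0"
proof -
  have h: "x = 0 \<and> y = 0" if "x + y * \<xi> = 0" "x + y * (- \<xi>) = 0" for x y
  proof -
    have "2 * x = (x + y * \<xi>) + (x + y * (- \<xi>))" by simp
    also have "\<dots> = 0" by (simp only: that add_0)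
    finally have "x = 0" using two by simp
    then show ?thesis using that \<xi>_nonzero by simp
  qed
  have comp: "(\<Sum>w\<in>basis. mscale (a w) (standard_rep w)) $ i $ j = 0" for i j
    by (simp add: assms(1))
  have "a 1 + a u * \<xi> = 0" "a 1 + a u * (- \<xi>) = 0" "a v + a (u * v) * (- \<xi>) = 0"
    using comp[of 1 1] comp[of 2 2] comp[of 2 1]
    by (simp_all only: sum_basis standard_rep_basis mat_1_2 mat2_nth vector_add_component mscale_nth
        mult_1_right mult_zero_right add_0 add_0_right)
  moreover have "\<iota> \<beta> * (a v + a (u * v) * \<xi>) = 0"
    using comp[of 1 2] by (simp add: sum_basis standard_rep_basis mat_1_2 algebra_simps)
  then have "a v + a (u * v) * \<xi> = 0"
    using \<beta>_nonzero by (simp add: \<iota>_eq_0)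
  ultimately have "a 1 = 0 \<and> a u = 0" "a v = 0 \<and> a (u * v) = 0"
    using h by blast+
  then show ?thesis
    using assms(2) by auto
qed

text \<open>Conjugate the standard representation by the matrix \<open>A\<close> with columns \<open>e\<close> and \<open>f\<close>. From \<open>A' = A P\<close> and
  hence \<open>B' = - P B\<close> for the inverse \<open>B\<close>, one gets
  \<open>(A X B)' = A (X' + P X - X P) B\<close>, and the bracket is the image of \<open>d x\<close> if \<open>X\<close> is that of \<open>x\<close>.\<close>

lemma differential_frame_imp_split:
  assumes "differential_frame e f p"
  shows "split_by smul d \<iota> E"
proof -
  define D where "D = e $ 1 * f $ 2 - e $ 2 * f $ 1"
  define A where "A = mat2 (e $ 1) (f $ 1) (e $ 2) (f $ 2)"
  define B where "B = mscale (inverse D) (mat2 (f $ 2) (- f $ 1) (- e $ 2) (e $ 1))"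
  let ?P = "connection p" and ?R = standard_rep
  have "D \<noteq> 0" and frame: "E (e $ i) = p * e $ i - c_minus * f $ i"
    "E (f $ i) = (p + 2 * m) * f $ i - c_plus * \<iota> \<beta> * e $ i" for i
    using assms by (simp_all add: differential_frame_def D_def vec_eq_iff)
  have DD: "e $ 1 * (inverse D * f $ 2) - f $ 1 * (inverse D * e $ 2) = 1"
  proof -
    have "inverse D * D = 1" using \<open>D \<noteq> 0\<close> by simp
    then show ?thesis by (simp add: D_def algebra_simps)
  qed
  have AB: "A ** B = mat 1" and BA: "B ** A = mat 1"
    using DD by (simp_all add: A_def B_def mat2_eq_iff matrix_mult_2 mat_1_2 algebra_simps)
  have A': "matrix_deriv E A = A ** ?P"
    by (simp add: A_def mat2_eq_iff matrix_mult_2 connection_def frame algebra_simps)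
  have "?P + matrix_deriv E B ** A = 0"
    using matrix_deriv_mult[OF E, of B A] by (simp add: BA A' matrix_mul_assoc matrix_deriv_1[OF E])
  then have "(?P + matrix_deriv E B ** A) ** B = 0"
    by simp
  then have "?P ** B + matrix_deriv E B = 0"
    by (simp add: matrix_mul_add_left AB flip: matrix_mul_assoc)
  then have B': "matrix_deriv E B = - (?P ** B)"
    by (simp add: eq_neg_iff_add_eq_0 add.commute)
  define \<psi> where "\<psi> x = A ** ?R x ** B" for x
  have conj: "A ** (B ** N ** A) ** B = N" "B ** (A ** N ** B) ** A = N" for N
    by (metis AB BA matrix_mul_assoc matrix_mul_lid matrix_mul_rid)+
  have sum: "(\<Sum>w\<in>basis. mscale (a w) (\<psi> w)) = A ** (\<Sum>w\<in>basis. mscale (a w) (?R w)) ** B" for a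
    by (simp add: sum_basis \<psi>_def matrix_mul_add_left matrix_mul_add_right mscale_mult_left mscale_mult_right)
  have "\<psi> (d x) = matrix_deriv E (\<psi> x)" for x
  proof -
    have "?R (d x) = matrix_deriv E (?R x) + ?P ** ?R x - ?R x ** ?P"
      using standard_rep_deriv[of x p] by (simp add: algebra_simps)
    then have "\<psi> (d x) = A ** (matrix_deriv E (?R x) + ?P ** ?R x - ?R x ** ?P) ** B"
      by (simp only: \<psi>_def)
    also have "\<dots> = matrix_deriv E (\<psi> x)"
      by (simp add: \<psi>_def matrix_deriv_mult[OF E] A' B' matrix_mul_add_left matrix_mul_add_right
          matrix_mul_diff_left matrix_mul_diff_right matrix_mul_minus_right matrix_mul_assoc
          algebra_simps)
    finally show ?thesis .
  qed
  moreover have "\<psi> (x * y) = \<psi> x ** \<psi> y" for x y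
    unfolding \<psi>_def standard_rep_mult by (metis BA matrix_mul_assoc matrix_mul_lid)
  ultimately have rep: "differential_representation smul d \<iota> E \<psi>"
    by (simp add: differential_representation_def \<psi>_def standard_rep_add standard_rep_smul
        standard_rep_basis AB matrix_mul_add_left matrix_mul_add_right mscale_mult_left mscale_mult_right)
  show ?thesis
  proof (rule representation_imp_split[OF algebra d E E_\<iota> rep _ basis_span])
    fix N
    obtain a where a: "B ** N ** A = (\<Sum>w\<in>basis. mscale (a w) (?R w))"
      using standard_rep_span by blast
    show "\<exists>a. N = (\<Sum>w\<in>basis. mscale (a w) (\<psi> w))"
      unfolding sum by (rule exI[of _ a]) (simp only: conj flip: a)
  next
    fix a w
    assume "(\<Sum>w\<in>basis. mscale (a w) (\<psi> w)) = 0" and w: "w \<in> basis"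
    then have "B ** (A ** (\<Sum>w\<in>basis. mscale (a w) (?R w)) ** B) ** A = 0"
      by (simp add: sum)
    then show "a w = 0"
      unfolding conj using w by (rule standard_rep_independent)
  qed simp
qed

text \<open>The frame consists of an eigenvector \<open>e\<close> of \<open>u\<close> for \<open>\<xi>\<close> and of its image under \<open>v\<close>, an eigenvector
  for \<open>- \<xi>\<close> because \<open>u\<close> and \<open>v\<close> anticommute. Differentiating \<open>u e = \<xi> e\<close> determines the \<open>f\<close>-coordinate
  of \<open>e'\<close>, and differentiating \<open>f = v e\<close> then determines \<open>f'\<close>; the \<open>e\<close>-coordinate \<open>p\<close> of \<open>e'\<close>
  depends on the scaling of \<open>e\<close> and remains a parameter.\<close>

lemma split_imp_differential_frame:
  assumes "split_by smul d \<iota> E"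
  shows "\<exists>e f p. differential_frame e f p"
proof -
  obtain \<psi> where "differential_representation smul d \<iota> E \<psi>"
    using split_imp_representation[OF algebra d E E_\<iota> assms] by blast
  then have \<psi>: "\<psi> (x + y) = \<psi> x + \<psi> y" "\<psi> (smul c x) = mscale (\<iota> c) (\<psi> x)" "\<psi> 1 = mat 1"
    "\<psi> (x * y) = \<psi> x ** \<psi> y" "matrix_deriv E (\<psi> x) = \<psi> (d x)" for c x y
    by (simp_all add: differential_representation_def)
  define U where "U w = \<psi> u *v w" for w
  define V where "V w = \<psi> v *v w" for w
  have U_add: "U (w + z) = U w + U z" and V_add: "V (w + z) = V w + V z"
    and U_scale: "U (c *s w) = c *s U w" and V_scale: "V (c *s w) = c *s V w" for c w z
    by (simp_all add: U_def V_def matrix_vector_right_distrib vector_scalar_commute)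
  have UU: "U (U w) = \<iota> \<alpha> *s w" for w
    by (simp add: U_def matrix_vector_mul_assoc flip: \<psi>(4)) (simp add: u_square \<psi> mscale_vec)
  have VV: "V (V w) = \<iota> \<beta> *s w" for w
    by (simp add: V_def matrix_vector_mul_assoc flip: \<psi>(4)) (simp add: v_square \<psi> mscale_vec)
  have UV: "\<psi> (u * v) *v w = U (V w)" for w
    by (simp add: U_def V_def \<psi> matrix_vector_mul_assoc)
  have VU: "V (U w) = - U (V w)" for w
  proof -
    have "V (U w) = \<psi> (v * u) *v w"
      by (simp add: U_def V_def \<psi>(4) matrix_vector_mul_assoc)
    also have "\<dots> = (- 1) *s (\<psi> (u * v) *v w)"
      unfolding vu \<psi>(2) mscale_vec by (simp add: \<iota>_minus \<iota>_1)
    finally show ?thesis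
      by (simp add: UV vec_eq_iff)
  qed
  have Vinj: "w = 0" if "V w = 0" for w :: "'l^2"
  proof -
    have "V 0 = 0" by (simp add: V_def)
    then have "\<iota> \<beta> *s w = 0" using VV[of w] that by simp
    then show ?thesis using \<beta>_nonzero by (simp add: \<iota>_eq_0)
  qed
  have sign: "w = 0" if "\<xi> *s w = - (\<xi> *s w)" for w :: "'l^2"
    using that two \<xi>_nonzero by (simp add: vec_eq_iff eq_neg_iff_add_eq_0 flip: mult_2)
  \<comment> \<open>Otherwise \<open>u\<close> would act as a scalar and commute with \<open>v\<close>.\<close>
  have "\<exists>w. U w + \<xi> *s w \<noteq> 0"
  proof (rule ccontr)
    assume "\<not> ?thesis"
    then have *: "U w = - (\<xi> *s w)" for w
      by (metis eq_neg_iff_add_eq_0)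
    have "V (- (\<xi> *s w)) = - (\<xi> *s V w)" for w
      using V_scale[of "- \<xi>" w] by simp
    then have "- (\<xi> *s V w) = \<xi> *s V w" for w
      using VU[of w] by (simp add: *)
    then have "w = 0" for w :: "'l^2"
      using sign[of "V w"] Vinj[of w] by metis
    then show False
      by (metis one_neq_zero one_index zero_index)
  qed
  then obtain w where w: "U w + \<xi> *s w \<noteq> 0" ..
  \<comment> \<open>This is an eigenvector for \<open>\<xi>\<close> as \<open>(u - \<xi>) (u + \<xi>) = 0\<close>.\<close>
  define e where "e = U w + \<xi> *s w"
  have "e \<noteq> 0" using w by (simp add: e_def)
  have "U e = \<iota> \<alpha> *s w + \<xi> *s U w"
    by (simp only: e_def U_add U_scale UU)
  then have Ue: "U e = \<xi> *s e"
    by (simp add: e_def vec_eq_iff \<xi>_\<xi> algebra_simps)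
  define f where "f = V e"
  have Uf: "U f = - (\<xi> *s f)" and Vf: "V f = \<iota> \<beta> *s e" and "f \<noteq> 0"
    using VU[of e] VV[of e] Vinj[of e] \<open>e \<noteq> 0\<close> by (auto simp: f_def Ue V_scale)
  define D where "D = e $ 1 * f $ 2 - e $ 2 * f $ 1"
  have "D \<noteq> 0"
  proof
    assume "D = 0"
    obtain i where i: "e $ i \<noteq> 0"
      using \<open>e \<noteq> 0\<close> by (auto simp: vec_eq_iff)
    have "e $ i *s f = f $ i *s e"
      using \<open>D = 0\<close> exhaust_2[of i] by (auto simp: D_def vec_eq_iff forall_2 algebra_simps)
    then have f: "f = (f $ i / e $ i) *s e"
      using i by (simp add: vec_eq_iff field_simps)
    have "U f = \<xi> *s f"
      by (subst (1 2) f) (simp add: U_scale Ue mult.commute)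
    then show False
      using Uf sign[of f] \<open>f \<noteq> 0\<close> by simp
  qed
  have expand: "\<exists>p q. w = p *s e + q *s f" for w
  proof (intro exI)
    \<comment> \<open>Cramer's rule\<close>
    show "w = ((w $ 1 * f $ 2 - w $ 2 * f $ 1) / D) *s e + ((e $ 1 * w $ 2 - e $ 2 * w $ 1) / D) *s f"
      using \<open>D \<noteq> 0\<close> by (simp add: vec_eq_iff forall_2 field_simps) (simp add: D_def algebra_simps)
  qed
  have coeff: "s = t" if "s *s f = t *s f" for s t
    using that \<open>f \<noteq> 0\<close> by simp
  \<comment> \<open>The coefficient \<open>q\<close> is found by comparing the coefficients of \<open>f\<close> in \<open>(u e)' = (\<xi> e)'\<close>.\<close>
  obtain p q where e': "vec_deriv E e = p *s e + q *s f"
    using expand by blast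
  let ?g = "\<lambda>\<gamma>. \<iota> (\<delta> \<gamma> / (2 * \<gamma>))"
  have "vec_deriv E (U e) = U (vec_deriv E e) + \<psi> (d u) *v e"
    by (simp add: U_def vec_deriv_mult[OF E] \<psi>(5))
  moreover have "\<psi> (d u) *v e = ?g \<alpha> *s U e + \<iota> (2 * a3 * \<alpha>) *s V e + \<iota> (2 * a2) *s U (V e)"
    by (simp add: d_u \<psi>(1,2) UV mscale_vec matrix_vector_mult_add_rdistrib flip: U_def V_def)
  moreover have "\<iota> (2 * a3 * \<alpha>) = 2 * (\<iota> a3 * (\<xi> * \<xi>))" "\<iota> (2 * a2) = 2 * \<iota> a2"
    by (simp_all add: \<iota>_mult \<iota>_2 \<xi>_\<xi>)
  ultimately have "\<xi> *s (p *s e + q *s f) + E \<xi> *s e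
      = p *s (\<xi> *s e) + q *s (- (\<xi> *s f))
        + (?g \<alpha> *s (\<xi> *s e) + (2 * (\<iota> a3 * (\<xi> * \<xi>))) *s f + (2 * \<iota> a2) *s (- (\<xi> *s f)))"
    (is "?lhs = ?rhs")
    by (simp only: Ue vec_deriv_scale[OF E] e' U_add U_scale Uf flip: f_def)
  moreover have "(2 * \<xi> * q) *s f - (2 * \<xi> * - c_minus) *s f = ?lhs - ?rhs"
    by (simp add: vec_eq_iff E_\<xi> c_minus_def algebra_simps)
  ultimately have "(2 * \<xi> * q) *s f = (2 * \<xi> * - c_minus) *s f"
    by (simp only: right_minus_eq diff_self)
  then have "2 * \<xi> * q = 2 * \<xi> * - c_minus"
    by (rule coeff)
  moreover have "2 * \<xi> \<noteq> 0"
    using two \<xi>_nonzero by simp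
  ultimately have q: "q = - c_minus"
    using mult_left_cancel[of "2 * \<xi>" q "- c_minus"] by blast
  have "vec_deriv E f = V (vec_deriv E e) + \<psi> (d v) *v e"
    by (simp add: f_def V_def vec_deriv_mult[OF E] \<psi>(5))
  moreover have "\<psi> (d v) *v e = \<iota> (- 2 * a3 * \<beta>) *s U e + ?g \<beta> *s V e + \<iota> (- 2 * a1) *s U (V e)"
    by (simp add: d_v \<psi>(1,2) UV mscale_vec matrix_vector_mult_add_rdistrib del: scale_minus_left
        flip: U_def V_def)
  moreover have "\<iota> (- 2 * a3 * \<beta>) = - 2 * \<iota> a3 * \<iota> \<beta>" "\<iota> (- 2 * a1) = - 2 * \<iota> a1"
    by (simp_all add: \<iota>_mult \<iota>_2 \<iota>_minus)
  ultimately have f': "vec_deriv E f = p *s f + q *s (\<iota> \<beta> *s e) + ((- 2 * \<iota> a3 * \<iota> \<beta>) *s (\<xi> *s e)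
      + ?g \<beta> *s f + (- 2 * \<iota> a1) *s (- (\<xi> *s f)))"
    by (simp only: e' V_add V_scale Ue Uf Vf flip: f_def)
  have "2 * m = 2 * \<iota> a1 * \<xi> + ?g \<beta>"
    using \<beta>_nonzero two_k by (simp add: \<iota>_simps two_m)
  then have "vec_deriv E f = (p + 2 * m) *s f - (c_plus * \<iota> \<beta>) *s e"
    unfolding f' q by (simp only:) (simp add: vec_eq_iff c_plus_def c_minus_def algebra_simps)
  then have "differential_frame e f p"
    using \<open>D \<noteq> 0\<close> by (simp add: differential_frame_def D_def e' q vec_eq_iff)
  then show ?thesis by blast
qed

section \<open>Solutions of the Riccati equation\<close>

text \<open>The pair \<open>(x, y)\<close> is a row of a frame; the scalar \<open>p\<close> cancels from the derivative of the ratio.\<close>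

lemma frame_row_riccati:
  assumes x: "x \<noteq> 0" and "E x = p * x - c_minus * y" and "E y = (p + 2 * m) * y - c_plus * \<iota> \<beta> * x"
  shows "riccati (- y / x)"
proof -
  define t where "t = y / x"
  have y: "y = t * x" using x by (simp add: t_def)
  have "E t * x = (2 * m * t - c_plus * \<iota> \<beta> + c_minus * t\<^sup>2) * x"
    using assms(3) unfolding y derivation_mult[OF E] assms(2)
    by (simp add: power2_eq_square algebra_simps)
  then have "E (- t) = - (2 * m * t - c_plus * \<iota> \<beta> + c_minus * t\<^sup>2)"
    using x by (simp add: derivation_minus[OF E])
  then have "riccati (- t)"
    by (simp add: riccati_def)
  then show ?thesis by (simp add: t_def)
qed

text \<open>The ratios of the two rows differ as the determinant is nonzero. A row whose first entry vanishes is
  replaced by the sum of both rows, which solves the same linear system.\<close>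

lemma differential_frame_imp_two_solutions:
  assumes "differential_frame e f p"
  shows "\<exists>l1 l2. riccati l1 \<and> riccati l2 \<and> l1 \<noteq> l2"
proof -
  have D: "e $ 1 * f $ 2 - e $ 2 * f $ 1 \<noteq> 0"
    and e': "E (e $ i) = p * e $ i - c_minus * f $ i"
    and f': "E (f $ i) = (p + 2 * m) * f $ i - c_plus * \<iota> \<beta> * e $ i" for i
    using assms by (simp_all add: differential_frame_def vec_eq_iff)
  have solutions: "\<exists>l1 l2. riccati l1 \<and> riccati l2 \<and> l1 \<noteq> l2"
    if "x1 \<noteq> 0" "x2 \<noteq> 0" "x1 * y2 - x2 * y1 \<noteq> 0"
      "E x1 = p * x1 - c_minus * y1" "E y1 = (p + 2 * m) * y1 - c_plus * \<iota> \<beta> * x1"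
      "E x2 = p * x2 - c_minus * y2" "E y2 = (p + 2 * m) * y2 - c_plus * \<iota> \<beta> * x2"
    for x1 y1 x2 y2
  proof (intro exI conjI)
    show "riccati (- y1 / x1)"
      by (rule frame_row_riccati) fact+
    show "riccati (- y2 / x2)"
      by (rule frame_row_riccati) fact+
    show "- y1 / x1 \<noteq> - y2 / x2"
      using that(1-3) by (auto simp: field_simps)
  qed
  consider "e $ 1 \<noteq> 0" "e $ 2 \<noteq> 0" | "e $ 1 = 0" "e $ 2 \<noteq> 0" | "e $ 1 \<noteq> 0" "e $ 2 = 0"
    using D by fastforce
  then show ?thesis
  proof cases
    case 1
    then show ?thesis using solutions[OF _ _ D] e' f' by blast
  next
    case 2
    show ?thesis
    proof (rule solutions[where ?x1.0 = "e $ 1 + e $ 2" and ?x2.0 = "e $ 2"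
          and ?y1.0 = "f $ 1 + f $ 2" and ?y2.0 = "f $ 2"])
      show "(e $ 1 + e $ 2) * f $ 2 - e $ 2 * (f $ 1 + f $ 2) \<noteq> 0"
        using D by (simp add: algebra_simps)
    qed (use 2 in simp, use 2 in simp, simp_all add: derivation_add[OF E] e' f' algebra_simps)
  next
    case 3
    show ?thesis
    proof (rule solutions[where ?x1.0 = "e $ 1" and ?x2.0 = "e $ 1 + e $ 2"
          and ?y1.0 = "f $ 1" and ?y2.0 = "f $ 1 + f $ 2"])
      show "e $ 1 * (f $ 1 + f $ 2) - (e $ 1 + e $ 2) * f $ 1 \<noteq> 0"
        using D by (simp add: algebra_simps)
    qed (use 3 in simp, use 3 in simp, simp_all add: derivation_add[OF E] e' f' algebra_simps)
  qed
qed

lemma split_imp_two_solutions: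
  "split_by smul d \<iota> E \<Longrightarrow> \<exists>l1 l2. riccati l1 \<and> riccati l2 \<and> l1 \<noteq> l2"
  using split_imp_differential_frame differential_frame_imp_two_solutions by blast

text \<open>The frame has the rows \<open>(\<mu>, - \<mu> l1)\<close> and \<open>(\<nu>, - \<nu> l2)\<close> with \<open>p = - m\<close>. Subtracting the two Riccati equations
  gives the logarithmic derivative \<open>2 m - c_minus (l1 + l2)\<close> of \<open>l1 - l2\<close>, so that of
  \<open>\<nu> = 1 / (\<mu> (l1 - l2))\<close> is \<open>c_minus l2 - m\<close>, as required.\<close>

lemma two_solutions_imp_split:
  assumes "riccati l1" "riccati l2" "l1 \<noteq> l2" "\<mu> \<noteq> 0" and \<mu>: "E \<mu> = (c_minus * l1 - m) * \<mu>"
  shows "split_by smul d \<iota> E"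
proof -
  have l: "E l1 = c_plus * \<iota> \<beta> + 2 * m * l1 - c_minus * l1\<^sup>2"
    "E l2 = c_plus * \<iota> \<beta> + 2 * m * l2 - c_minus * l2\<^sup>2"
    using assms(1,2) by (simp_all add: riccati_def)
  define \<nu> where "\<nu> = inverse (\<mu> * (l1 - l2))"
  have "E (\<mu> * (l1 - l2)) = (m - c_minus * l2) * (\<mu> * (l1 - l2))"
    by (simp add: derivation_mult[OF E] derivation_diff[OF E] \<mu> l power2_eq_square algebra_simps)
  from derivation_inverse_exponential[OF E _ this] have "E \<nu> = - (m - c_minus * l2) * \<nu>"
    unfolding \<nu>_def using assms(3,4) by simp
  then have \<nu>: "E \<nu> = (c_minus * l2 - m) * \<nu>"
    by simp
  have "\<mu> * (- \<nu> * l2) - \<nu> * (- \<mu> * l1) = \<mu> * \<nu> * (l1 - l2)"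
    by (simp add: algebra_simps)
  then have "\<mu> * (- \<nu> * l2) - \<nu> * (- \<mu> * l1) \<noteq> 0"
    using assms(3,4) by (simp add: \<nu>_def)
  moreover have "E y = - m * y - c_minus * (- y * l)"
      "E (- y * l) = (- m + 2 * m) * (- y * l) - c_plus * \<iota> \<beta> * y"
    if "E y = (c_minus * l - m) * y" "E l = c_plus * \<iota> \<beta> + 2 * m * l - c_minus * l\<^sup>2" for y l
    by (simp_all add: derivation_mult[OF E] derivation_minus[OF E] that power2_eq_square algebra_simps)
  note this[OF \<mu> l(1)] this[OF \<nu> l(2)]
  ultimately have "differential_frame (vector [\<mu>, \<nu>]) (vector [- \<mu> * l1, - \<nu> * l2]) (- m)"
    by (simp only: differential_frame_def vec_eq_iff forall_2 vec_deriv_nth vector_2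
        vector_minus_component vector_smult_component simp_thms)
  then show ?thesis by (rule differential_frame_imp_split)
qed

end

section \<open>The splitting criterion\<close>

text \<open>The embedding \<open>\<kappa>\<close> carries the whole situation over \<open>L\<close> to \<open>L(\<mu>)\<close>, including solutions of the
  Riccati equation.\<close>

lemma (in quaternion_over_splitting_field) exponential_extension_split:
  fixes \<kappa> :: "'l \<Rightarrow> 'm::field"
  assumes ext: "exponential_extension E \<kappa> F \<mu> (c_minus * l1 - m)"
    and l: "riccati l1" "riccati l2" "l1 \<noteq> l2"
  shows "split_by smul d (\<lambda>c. \<kappa> (\<iota> c)) F"
proof -
  have \<kappa>: "\<kappa> 1 = 1" "\<kappa> (x + y) = \<kappa> x + \<kappa> y" "\<kappa> (x * y) = \<kappa> x * \<kappa> y" "F (\<kappa> x) = \<kappa> (E x)"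
    and F: "derivation F" and \<mu>: "\<mu> \<noteq> 0" "F \<mu> / \<mu> = \<kappa> (c_minus * l1 - m)" for x y
    using ext by (auto simp: exponential_extension_def diff_field_extension_def)
  have \<kappa>_0: "\<kappa> 0 = 0"
    by (metis \<kappa>(2) add_cancel_right_right)
  have \<kappa>_minus: "\<kappa> (- x) = - \<kappa> x" for x
    using \<kappa>(2)[of x "- x"] \<kappa>_0 by (simp add: eq_neg_iff_add_eq_0 add.commute)
  have \<kappa>_diff: "\<kappa> (x - y) = \<kappa> x - \<kappa> y" for x y
    using \<kappa>(2)[of x "- y"] \<kappa>_minus by simp
  have \<kappa>_inj: "x = 0" if "\<kappa> x = 0" for x
    using \<kappa>(3)[of x "inverse x"] \<kappa>(1) that by (cases "x = 0") auto
  have \<kappa>_divide: "\<kappa> (x / y) = \<kappa> x / \<kappa> y" if "y \<noteq> 0" for x y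
    using \<kappa>(3)[of "x / y" y] \<kappa>_inj[of y] that by (auto simp: eq_divide_eq)
  have \<kappa>_2: "\<kappa> 2 = 2"
    using \<kappa>(2)[of 1 1] \<kappa>(1) by simp
  have \<kappa>_4: "\<kappa> 4 = 4"
    using \<kappa>(2)[of 2 2] \<kappa>_2 by simp
  have four: "(4::'l) \<noteq> 0"
    using two mult_eq_0_iff[of "2::'l" 2] by simp
  interpret ext: quaternion_over_splitting_field smul \<alpha> \<beta> u v \<delta> d a1 a2 a3 "\<lambda>c. \<kappa> (\<iota> c)" F "\<kappa> \<xi>"
  proof
    show "(\<kappa> \<xi>)\<^sup>2 = \<kappa> (\<iota> \<alpha>)"
      by (simp add: power2_eq_square \<xi>_\<xi> flip: \<kappa>(3))
    show "(2::'m) \<noteq> 0"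
      using \<kappa>_2 \<kappa>_inj[of 2] two by auto
  qed (simp_all add: d d_u d_v F \<kappa> \<iota>_1 \<iota>_add \<iota>_mult E_\<iota>)
  have c: "ext.c_plus = \<kappa> c_plus" "ext.c_minus = \<kappa> c_minus"
    by (simp_all add: ext.c_plus_def ext.c_minus_def c_plus_def c_minus_def \<kappa> \<kappa>_diff)
  have m: "ext.m = \<kappa> m"
    using four \<beta>_nonzero by (simp add: ext.m_def m_def \<kappa> \<kappa>_divide \<kappa>_4 \<iota>_eq_0)
  have riccati: "ext.riccati (\<kappa> x)" if "riccati x" for x
    using that by (simp add: ext.riccati_def riccati_def c m \<kappa> \<kappa>_diff \<kappa>_2 power2_eq_square)
  show ?thesis
  proof (rule ext.two_solutions_imp_split)
    show "ext.riccati (\<kappa> l1)" "ext.riccati (\<kappa> l2)"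
      using l riccati by auto
    show "\<kappa> l1 \<noteq> \<kappa> l2"
      using \<kappa>_diff[of l1 l2] \<kappa>_inj[of "l1 - l2"] l(3) by auto
    show "\<mu> \<noteq> 0" by fact
    show "F \<mu> = (ext.c_minus * \<kappa> l1 - ext.m) * \<mu>"
      using \<mu> by (simp add: c m \<kappa> \<kappa>_diff divide_eq_eq)
  qed
qed

theorem proposition4p1:
  fixes \<delta> :: "'k::field \<Rightarrow> 'k"
    and smul :: "'k \<Rightarrow> 'q::ring_1 \<Rightarrow> 'q"
    and \<alpha> \<beta> a1 a2 a3 :: 'k
    and u v \<theta> :: 'q
    and d d_uv :: "'q \<Rightarrow> 'q"
    and \<xi> :: "'k alg_closure"
    and D :: "'k alg_closure \<Rightarrow> 'k alg_closure"
    and j :: "'k alg_closure \<Rightarrow> 'l::field"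
    and E :: "'l \<Rightarrow> 'l"
    and \<iota> :: "'k \<Rightarrow> 'l"
    and S :: "'l set"
  assumes "derivation \<delta>"
    and "CHAR('k) \<noteq> 2"
    and "quaternion_algebra smul \<alpha> \<beta> u v"
    and "derivation_extending smul \<delta> d"
    and "standard_derivation smul \<delta> u v d_uv"
    and "\<theta> = smul a1 u + smul a2 v + smul a3 (u * v)"
    and "\<And>x. d x = d_uv x + inner_derivation \<theta> x"
    and "\<xi>\<^sup>2 = to_ac \<alpha>"
    and "derivation_on (field_gen (insert \<xi> (range to_ac))) D"
    and "\<And>c. D (to_ac c) = to_ac (\<delta> c)"
    and "diff_field_extension (field_gen (insert \<xi> (range to_ac))) D j E"
  defines "\<iota> \<equiv> (\<lambda>c. j (to_ac c))"
  defines "S \<equiv> {x. E x = (\<iota> a2 + \<iota> a3 * j \<xi>) * \<iota> \<beta>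
                       + 2 * (\<iota> a1 * j \<xi> + \<iota> (\<delta> \<beta>) / (4 * \<iota> \<beta>)) * x
                       - (\<iota> a2 - \<iota> a3 * j \<xi>) * x\<^sup>2}"
  shows "(split_by smul d \<iota> E \<longrightarrow> (\<exists>l1\<in>S. \<exists>l2\<in>S. l1 \<noteq> l2))
    \<and> (\<forall>l1\<in>S. \<forall>l2\<in>S. l1 \<noteq> l2 \<longrightarrow>
        (\<exists>(\<kappa> :: 'l \<Rightarrow> 'l poly fract) F \<mu>.
            exponential_extension E \<kappa> F \<mu>
              ((\<iota> a2 - \<iota> a3 * j \<xi>) * l1 - (\<iota> a1 * j \<xi> + \<iota> (\<delta> \<beta>) / (4 * \<iota> \<beta>)))
            \<and> split_by smul d (\<lambda>c. \<kappa> (\<iota> c)) F)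
      \<and> (\<forall>(\<kappa> :: 'l \<Rightarrow> 'm::field) F \<mu>.
            exponential_extension E \<kappa> F \<mu>
              ((\<iota> a2 - \<iota> a3 * j \<xi>) * l1 - (\<iota> a1 * j \<xi> + \<iota> (\<delta> \<beta>) / (4 * \<iota> \<beta>)))
            \<longrightarrow> split_by smul d (\<lambda>c. \<kappa> (\<iota> c)) F))"
proof -
  interpret Q: quaternion_algebra smul \<alpha> \<beta> u v by fact
  let ?K = "field_gen (insert \<xi> (range to_ac))"
  have K: "\<xi> \<in> ?K" "to_ac c \<in> ?K" for c
    by (auto intro: field_gen_incl)
  have E: "derivation E" and j: "j 1 = 1" "\<And>x y. x \<in> ?K \<Longrightarrow> y \<in> ?K \<Longrightarrow> j (x + y) = j x + j y"
    "\<And>x y. x \<in> ?K \<Longrightarrow> y \<in> ?K \<Longrightarrow> j (x * y) = j x * j y" "\<And>x. x \<in> ?K \<Longrightarrow> j (D x) = E (j x)"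
    using assms(11) by (simp_all add: diff_field_extension_def)
  have \<iota>: "\<iota> 1 = 1" "\<iota> (x + y) = \<iota> x + \<iota> y" "\<iota> (x * y) = \<iota> x * \<iota> y" for x y
    by (simp_all add: \<iota>_def j K)
  have two: "(2::'k) \<noteq> 0"
  proof
    assume "(2::'k) = 0"
    then have "CHAR('k) dvd 2"
      using of_nat_eq_0_iff_char_dvd[of 2, where ?'a = 'k] by simp
    then have "CHAR('k) \<le> 2" by (rule dvd_imp_le) simp
    moreover have "CHAR('k) \<noteq> 0" using \<open>CHAR('k) dvd 2\<close> by (metis dvd_0_left zero_neq_numeral)
    moreover have "CHAR('k) \<noteq> 1" by simp
    ultimately show False using assms(2) by linarith
  qed
  have "(2::'l) \<noteq> 0"
  proof
    assume "(2::'l) = 0"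
    moreover have "\<iota> 2 = 2" using \<iota>(2)[of 1 1] \<iota>(1) by simp
    moreover have "\<iota> 2 * \<iota> (inverse 2) = 1" using \<iota>(3)[of 2 "inverse 2"] \<iota>(1) two by simp
    ultimately show False by simp
  qed
  moreover have "(j \<xi>)\<^sup>2 = \<iota> \<alpha>"
    using j(3)[OF K(1) K(1)] assms(8) by (simp add: \<iota>_def power2_eq_square)
  moreover have "E (\<iota> c) = \<iota> (\<delta> c)" for c
    using j(4)[OF K(2), of c] by (simp add: \<iota>_def assms(10))
  ultimately interpret quaternion_over_splitting_field smul \<alpha> \<beta> u v \<delta> d a1 a2 a3 \<iota> E "j \<xi>"
    using \<iota> E assms(4) Q.derivation_on_generators[OF two assms(5,6,7)]
    by unfold_locales auto
  have S: "x \<in> S \<longleftrightarrow> riccati x" for x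
    by (simp add: S_def riccati_def c_plus_def c_minus_def m_def)
  show ?thesis
    unfolding c_minus_def[symmetric] m_def[symmetric]
  proof (intro conjI impI ballI allI)
    assume "split_by smul d \<iota> E"
    then show "\<exists>l1\<in>S. \<exists>l2\<in>S. l1 \<noteq> l2"
      using split_imp_two_solutions S by blast
  next
    fix l1 l2
    assume l: "l1 \<in> S" "l2 \<in> S" "l1 \<noteq> l2"
    then show "\<exists>(\<kappa> :: 'l \<Rightarrow> 'l poly fract) F \<mu>. exponential_extension E \<kappa> F \<mu> (c_minus * l1 - m)
        \<and> split_by smul d (\<lambda>c. \<kappa> (\<iota> c)) F"
      using exponential_extension_exists[OF E] exponential_extension_split S by blast
    fix \<kappa> :: "'l \<Rightarrow> 'm" and F \<mu>
    assume "exponential_extension E \<kappa> F \<mu> (c_minus * l1 - m)"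
    then show "split_by smul d (\<lambda>c. \<kappa> (\<iota> c)) F"
      using exponential_extension_split l S by blast
  qed
qed

end
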